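(* Let $n\ge 2$ be an integer, $\lambda>\frac{1}{n-1}$ and $\mu<0$. Then the initial value problem $$f_{rr}(r)+\frac{n-1}{r}\,(1+f_r(r)^2)\,f_r(r)-\frac{1}{\lambda}\cdot\frac{(1+f_r(r)^2)^2}{r f_r(r)-f(r)}=0\quad\text{for all } r>0,\qquad f(0)=\mu,\quad f_r(0)=0,$$ has a unique solution $f\in C^1([0,\infty))\cap C^2(0,\infty)$ which satisfies $$r f_r(r)>f(r)\quad\text{for all } r\ge 0\qquad\text{and}\qquad f_r(r)>0\quad\text{for all } r>0.$$
   Context: Here $f$ is a real-valued function of one real variable $r\ge 0$; $f_r$ and $f_{rr}$ denote its first and second derivatives, the derivative at $r=0$ being one-sided. Being a solution of the equation entails that the denominator $r f_r(r)-f(r)$ does not vanish. *)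

theory Defs
  imports "HOL-Analysis.Analysis"
begin

text \<open>The profile function is encoded as a total function on the reals of which only the values
  on the half line \<open>{0..}\<close> matter. Its derivative is therefore taken within
  \<open>{0..}\<close>: one-sided at 0 and the ordinary derivative at every positive point.\<close>

definition hderiv :: "(real \<Rightarrow> real) \<Rightarrow> real \<Rightarrow> real" where
  "hderiv f r = vector_derivative f (at r within {0..})"

definition C1_closed_half_line :: "(real \<Rightarrow> real) \<Rightarrow> bool" where
  "C1_closed_half_line f \<longleftrightarrow> f differentiable_on {0..} \<and> continuous_on {0..} (hderiv f)"

definition C2_open_half_line :: "(real \<Rightarrow> real) \<Rightarrow> bool" where
  "C2_open_half_line f \<longleftrightarrow> f differentiable_on {0<..} \<and> hderiv f C1_differentiable_on {0<..}"

text \<open>The denominator is required not to vanish, since division by zero is total in HOL.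
  In the equation, \<open>deriv (hderiv f) r\<close> is the second derivative of \<open>f\<close> at
  \<open>r > 0\<close>.\<close>

definition ivp_solution :: "nat \<Rightarrow> real \<Rightarrow> real \<Rightarrow> (real \<Rightarrow> real) \<Rightarrow> bool" where
  "ivp_solution n lam \<mu> f \<longleftrightarrow>
     C1_closed_half_line f \<and> C2_open_half_line f \<and>
     (\<forall>r>0. r * hderiv f r - f r \<noteq> 0 \<and>
        deriv (hderiv f) r
          + (real n - 1) / r * (1 + (hderiv f r)\<^sup>2) * hderiv f r
          - 1 / lam * ((1 + (hderiv f r)\<^sup>2)\<^sup>2 / (r * hderiv f r - f r)) = 0) \<and>
     f 0 = \<mu> \<and> hderiv f 0 = 0"

end

theory Submission
  imports Defs
begin

text \<open>
  Write \<open>k = n - 1\<close>, \<open>p\<close> for the derivative of \<open>f\<close> and \<open>g = r p - f\<close> for the gap in the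
  denominator, so that \<open>g' = r p'\<close> and \<open>g(0) = - \<mu> > 0\<close>.  The equation says that \<open>p'\<close> is a positive
  multiple of the excess \<open>E = r (1 + p\<^sup>2) - lam k p g\<close>.

  The sign of \<open>E\<close> controls everything.  Near \<open>0\<close> the slope is asymptotically linear, which makes \<open>E\<close>
  positive; at a first zero of \<open>E\<close> one has \<open>p' = g' = 0\<close>, so \<open>E' = 1 + p\<^sup>2 > 0\<close>, which is impossible
  for a function that comes down to zero (\<open>excess_pos\<close>).  Hence \<open>p\<close> increases, \<open>g\<close> increases and
  is at least \<open>- \<mu>\<close>.  The inequality \<open>E > 0\<close> also reads
  \<open>(ln g)' \<ge> (lam k / 2) (ln (1 + p\<^sup>2))'\<close>, whence \<open>g \<ge> (- \<mu>) (1 + p\<^sup>2) powr (lam k / 2)\<close>.  But \<open>g\<close> grows at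
  most linearly in \<open>sqrt (1 + p\<^sup>2)\<close>, namely \<open>g \<le> (r - \<mu>) sqrt (1 + p\<^sup>2)\<close>.  Since \<open>lam k > 1\<close>, the two
  bounds together limit \<open>p\<close> by an explicit function of \<open>r\<close> (\<open>slope_bound_sq\<close>), so no blow-up can occur.

  For existence and uniqueness the singular term at \<open>r = 0\<close> is absorbed by the divergence form of the
  equation: with \<open>s = p / sqrt (1 + p\<^sup>2)\<close>, the sine of the inclination angle,
  \<open>(r ^ k s)' = r ^ k sqrt (1 + p\<^sup>2) / (lam g)\<close> (\<open>DERIV_flux\<close>).  So \<open>s(r)\<close> is the integral of
  \<open>(t / r) ^ k sqrt (1 + p\<^sup>2) / (lam g)\<close> over \<open>t\<close> from \<open>0\<close> to \<open>r\<close>, where \<open>p\<close> and \<open>f = \<mu> + \<integral> p\<close> are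
  recovered from \<open>s\<close>.  The kernel is bounded by \<open>1\<close>.  Cutting off \<open>p\<close> at the a priori bound and \<open>g\<close> at
  \<open>- \<mu> / 2\<close> turns the right hand side into an operator that is Lipschitz in the causal sense on every
  bounded interval (\<open>flux_operator_lipschitz\<close>), so it has exactly one continuous fixed point on the half
  line.  Every solution of the initial value problem obeys the a priori bounds and is therefore a fixed
  point (\<open>profile_fixed_point\<close>), which gives uniqueness.  Conversely, up to the first radius at which a
  cut-off could become active the fixed point solves the original equation, so it obeys the strict a
  priori bounds there, and no such radius exists (\<open>global_profile_exists\<close>).
\<close>

section \<open>Fixed points of causal Lipschitz operators\<close>

lemma continuous_on_atLeast0I:
  fixes f :: "real \<Rightarrow> real"
  assumes "\<And>T. continuous_on {0..T} f"
  shows "continuous_on {0..} f"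
  unfolding continuous_on_eq_continuous_within
proof
  fix r :: real assume r: "r \<in> {0..}"
  have "continuous (at r within {0..r+1}) f"
    using assms[of "r+1"] r by (simp add: continuous_on_eq_continuous_within)
  moreover have "at r within {0..r+1} = at r within {0..}"
    by (rule at_within_nhd[of _ "{..<r+1}"]) auto
  ultimately show "continuous (at r within {0..}) f" by simp
qed

text \<open>The condition on \<open>\<Phi>\<close> is a Lipschitz estimate that at time \<open>r\<close> uses only the past \<open>{0..r}\<close>.
  Uniqueness is the Gronwall inequality for \<open>D(r) = \<integral>\<^sub>0\<^sup>r \<bar>x - y\<bar>\<close>, which satisfies \<open>D' \<le> L D\<close> and \<open>D 0 = 0\<close>.\<close>
lemma volterra_fixed_point_unique:
  fixes \<Phi> :: "(real \<Rightarrow> real) \<Rightarrow> real \<Rightarrow> real"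
  assumes lip: "\<And>T. \<exists>L\<ge>0. \<forall>x y r. continuous_on {0..} x \<longrightarrow> continuous_on {0..} y \<longrightarrow> 0 \<le> r \<longrightarrow> r \<le> T \<longrightarrow>
            \<bar>\<Phi> x r - \<Phi> y r\<bar> \<le> L * integral {0..r} (\<lambda>t. \<bar>x t - y t\<bar>)"
    and x: "continuous_on {0..} x" "\<And>r. r \<ge> 0 \<Longrightarrow> \<Phi> x r = x r"
    and y: "continuous_on {0..} y" "\<And>r. r \<ge> 0 \<Longrightarrow> \<Phi> y r = y r"
    and T: "T \<ge> 0"
  shows "x T = y T"
proof -
  obtain L where L: "L \<ge> 0" "\<And>r. 0 \<le> r \<Longrightarrow> r \<le> T \<Longrightarrow>
      \<bar>x r - y r\<bar> \<le> L * integral {0..r} (\<lambda>t. \<bar>x t - y t\<bar>)"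
    using lip[of T] x y by (metis (no_types, lifting))
  define D where "D r = integral {0..r} (\<lambda>t. \<bar>x t - y t\<bar>)" for r
  have cd: "continuous_on {0..T} (\<lambda>t. \<bar>x t - y t\<bar>)"
    by (intro continuous_intros continuous_on_subset[OF x(1)] continuous_on_subset[OF y(1)]) auto
  have Dnn: "D r \<ge> 0" for r
    unfolding D_def by (cases "(\<lambda>t. \<bar>x t - y t\<bar>) integrable_on {0..r}")
      (auto intro: integral_nonneg simp: not_integrable_integral)
  have D': "(D has_real_derivative \<bar>x r - y r\<bar>) (at r within {0..T})" if "r \<in> {0..T}" for r
    unfolding D_def has_real_derivative_iff_has_vector_derivative
    using integral_has_vector_derivative[OF cd that] .
  \<comment> \<open>The integrating factor \<open>exp (- L r)\<close> turns \<open>D' \<le> L D\<close> into monotonicity.\<close>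
  have "exp (- L * T) * D T \<le> exp (- L * 0) * D 0"
  proof (rule DERIV_nonpos_imp_decreasing_open[OF T])
    fix r assume r: "0 < r" "r < T"
    have 1: "(D has_real_derivative \<bar>x r - y r\<bar>) (at r)"
      using D'[of r] r by (simp add: at_within_Icc_at)
    have "((\<lambda>r. exp (- L * r) * D r) has_real_derivative exp (- L * r) * (\<bar>x r - y r\<bar> - L * D r)) (at r)"
      by (auto intro!: derivative_eq_intros 1 simp: algebra_simps)
    moreover have "exp (- L * r) * (\<bar>x r - y r\<bar> - L * D r) \<le> 0"
      using L(2)[of r] r unfolding D_def by (intro mult_nonneg_nonpos) auto
    ultimately show "\<exists>z. ((\<lambda>r. exp (- L * r) * D r) has_real_derivative z) (at r) \<and> z \<le> 0" by blast
  next
    have "continuous_on {0..T} D" by (rule DERIV_continuous_on[OF D'])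
    then show "continuous_on {0..T} (\<lambda>r. exp (- L * r) * D r)" by (intro continuous_intros)
  qed
  then have "D T \<le> 0" by (simp add: D_def mult_le_0_iff)
  then have "\<bar>x T - y T\<bar> \<le> 0"
    using L(2)[of T] T L(1) unfolding D_def[symmetric] by (meson mult_nonneg_nonpos order_trans order_refl)
  then show ?thesis by simp
qed

text \<open>Picard iteration: consecutive iterates differ by at most \<open>D (L r) ^ n / n!\<close> on \<open>{0..T}\<close>, so they
  converge uniformly on every bounded interval.  The limit is defined pointwise as a telescoping series,
  which makes it independent of \<open>T\<close>, and solutions on bounded intervals need no gluing.\<close>
lemma volterra_fixed_point_exists:
  fixes \<Phi> :: "(real \<Rightarrow> real) \<Rightarrow> real \<Rightarrow> real"
  assumes lip: "\<And>T. \<exists>L\<ge>0. \<forall>x y r. continuous_on {0..} x \<longrightarrow> continuous_on {0..} y \<longrightarrow> 0 \<le> r \<longrightarrow> r \<le> T \<longrightarrow>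
            \<bar>\<Phi> x r - \<Phi> y r\<bar> \<le> L * integral {0..r} (\<lambda>t. \<bar>x t - y t\<bar>)"
    and cont: "\<And>x. continuous_on {0..} x \<Longrightarrow> continuous_on {0..} (\<Phi> x)"
  shows "\<exists>x. continuous_on {0..} x \<and> (\<forall>r\<ge>0. \<Phi> x r = x r)"
proof -
  define X where "X n = (\<Phi> ^^ n) (\<lambda>_. 0)" for n
  have XS: "X (Suc n) = \<Phi> (X n)" for n by (simp add: X_def)
  have Xc: "continuous_on {0..} (X n)" for n
    by (induction n) (auto simp: X_def intro: cont)
  define x where "x r = (\<Sum>i. X (Suc i) r - X i r)" for r
  have telescope: "(\<Sum>i<n. X (Suc i) r - X i r) = X n r" for n r
    by (induction n) (auto simp: X_def)
  have unif: "uniform_limit {0..T} X x sequentially" for T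
  proof -
    obtain L where L: "L \<ge> 0" and Lip: "\<And>x y r. continuous_on {0..} x \<Longrightarrow> continuous_on {0..} y \<Longrightarrow> 0 \<le> r \<Longrightarrow> r \<le> T \<Longrightarrow>
            \<bar>\<Phi> x r - \<Phi> y r\<bar> \<le> L * integral {0..r} (\<lambda>t. \<bar>x t - y t\<bar>)"
      using lip[of T] by blast
    have "bounded (X 1 ` {0..T})"
      by (intro compact_imp_bounded compact_continuous_image continuous_on_subset[OF Xc]) auto
    then obtain D0 where D0: "\<And>r. r \<in> {0..T} \<Longrightarrow> \<bar>X 1 r\<bar> \<le> D0"
      unfolding bounded_iff by (metis imageI real_norm_def)
    define D where "D = max 0 D0"
    have D: "D \<ge> 0" "\<And>r. r \<in> {0..T} \<Longrightarrow> \<bar>X 1 r\<bar> \<le> D"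
      using D0 by (auto simp: D_def le_max_iff_disj)
    have step: "\<bar>X (Suc n) r - X n r\<bar> \<le> D * ((L * r) ^ n / fact n)" if "r \<in> {0..T}" for n r
      using that
    proof (induction n arbitrary: r)
      case 0
      then show ?case using D(2) by (simp add: X_def)
    next
      case (Suc n)
      have hi: "((\<lambda>t. D * (L ^ n * t ^ n / fact n)) has_integral
                 D * (L ^ n * r ^ Suc n / fact (Suc n)) - D * (L ^ n * 0 ^ Suc n / fact (Suc n))) {0..r}"
      proof (rule fundamental_theorem_of_calculus)
        show "0 \<le> r" using Suc.prems by simp
        fix t
        have "((\<lambda>t. D * (L ^ n * t ^ Suc n / fact (Suc n))) has_real_derivative 
               D * (L ^ n * (real (Suc n) * t ^ n) / fact (Suc n))) (at t within {0..r})"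
          by (rule derivative_eq_intros refl | simp)+
        moreover have "D * (L ^ n * (real (Suc n) * t ^ n) / fact (Suc n)) = D * (L ^ n * t ^ n / fact n)"
          by (simp add: divide_simps del: of_nat_Suc)
        ultimately show "((\<lambda>t. D * (L ^ n * t ^ Suc n / fact (Suc n))) has_vector_derivative D * (L ^ n * t ^ n / fact n)) (at t within {0..r})"
          by (simp only: has_real_derivative_iff_has_vector_derivative)
      qed
      have "\<bar>X (Suc (Suc n)) r - X (Suc n) r\<bar> \<le> L * integral {0..r} (\<lambda>t. \<bar>X (Suc n) t - X n t\<bar>)"
        unfolding XS[of "Suc n"] using Lip[OF Xc[of "Suc n"] Xc[of n], of r] Suc.prems by (simp add: XS)
      moreover have "integral {0..r} (\<lambda>t. \<bar>X (Suc n) t - X n t\<bar>) \<le> integral {0..r} (\<lambda>t. D * (L ^ n * t ^ n / fact n))"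
      proof (rule integral_le)
        show "(\<lambda>t. \<bar>X (Suc n) t - X n t\<bar>) integrable_on {0..r}"
          by (intro integrable_continuous_interval continuous_intros continuous_on_subset[OF Xc]) auto
        show "(\<lambda>t. D * (L ^ n * t ^ n / fact n)) integrable_on {0..r}" using hi by blast
        fix t assume "t \<in> {0..r}"
        then show "\<bar>X (Suc n) t - X n t\<bar> \<le> D * (L ^ n * t ^ n / fact n)"
          using Suc.IH[of t] Suc.prems by (simp add: power_mult_distrib)
      qed
      ultimately have "\<bar>X (Suc (Suc n)) r - X (Suc n) r\<bar> \<le> L * (D * (L ^ n * r ^ Suc n / fact (Suc n)))"
        using mult_left_mono[OF _ L, of "integral {0..r} (\<lambda>t. \<bar>X (Suc n) t - X n t\<bar>)"] integral_unique[OF hi]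
        by (fastforce intro: order_trans)
      then show ?case
        by (simp add: power_mult_distrib algebra_simps)
    qed
    have "uniform_limit {0..T} (\<lambda>n r. \<Sum>i<n. X (Suc i) r - X i r) x sequentially"
      unfolding x_def
    proof (rule Weierstrass_m_test)
      show "summable (\<lambda>n. D * ((L * T) ^ n / fact n))"
        using summable_exp[of "L * T"] by (intro summable_mult) (simp add: field_simps)
      show "norm (X (Suc n) r - X n r) \<le> D * ((L * T) ^ n / fact n)" if "r \<in> {0..T}" for n r
      proof -
        have "(L * r) ^ n \<le> (L * T) ^ n" using that L by (intro power_mono mult_left_mono) auto
        then have "D * ((L * r) ^ n / fact n) \<le> D * ((L * T) ^ n / fact n)"
          using D by (intro mult_left_mono divide_right_mono) auto
        then show ?thesis using step[OF that, of n] by simp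
      qed
    qed
    then show ?thesis by (simp add: telescope)
  qed
  have xT: "continuous_on {0..T} x" for T
    by (rule uniform_limit_theorem[OF _ unif])
      (auto intro!: always_eventually continuous_on_subset[OF Xc])
  have xc: "continuous_on {0..} x"
    by (rule continuous_on_atLeast0I) (rule xT)
  have "\<Phi> x r = x r" if r: "r \<ge> 0" for r
  proof (rule LIMSEQ_unique)
    have "(\<lambda>n. X n r) \<longlonglongrightarrow> x r"
      using tendsto_uniform_limitI[OF unif[of r]] r by simp
    then show "(\<lambda>n. X (Suc n) r) \<longlonglongrightarrow> x r" by (rule LIMSEQ_Suc)
    obtain L where L: "L \<ge> 0" and Lip: "\<And>x y. continuous_on {0..} x \<Longrightarrow> continuous_on {0..} y \<Longrightarrow>
            \<bar>\<Phi> x r - \<Phi> y r\<bar> \<le> L * integral {0..r} (\<lambda>t. \<bar>x t - y t\<bar>)"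
      using lip[of r] r by blast
    have cd: "continuous_on {0..r} (\<lambda>t. \<bar>X n t - x t\<bar>)" for n
      by (intro continuous_intros continuous_on_subset[OF Xc] continuous_on_subset[OF xc]) auto
    have "uniform_limit {0..r} (\<lambda>n t. \<bar>X n t - x t\<bar>) (\<lambda>t. 0) sequentially"
      using unif[of r] by (simp add: uniform_limit_iff dist_real_def)
    then obtain I J where IJ: "\<And>n. ((\<lambda>t. \<bar>X n t - x t\<bar>) has_integral I n) {0..r}"
        "((\<lambda>t. 0::real) has_integral J) {0..r}" "I \<longlonglongrightarrow> J"
      by (rule uniform_limit_integral[OF _ cd trivial_limit_sequentially]) blast
    have lim: "(\<lambda>n. integral {0..r} (\<lambda>t. \<bar>X n t - x t\<bar>)) \<longlonglongrightarrow> 0"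
      using IJ(3) by (simp add: integral_unique[OF IJ(1)] has_integral_unique[OF IJ(2) has_integral_0])
    show "(\<lambda>n. X (Suc n) r) \<longlonglongrightarrow> \<Phi> x r"
    proof (rule LIM_zero_cancel, rule tendsto_0_le[where K = L, OF lim])
      have "norm (X (Suc n) r - \<Phi> x r) \<le> norm (integral {0..r} (\<lambda>t. \<bar>X n t - x t\<bar>)) * L" for n
      proof -
        have "norm (X (Suc n) r - \<Phi> x r) \<le> L * integral {0..r} (\<lambda>t. \<bar>X n t - x t\<bar>)"
          using Lip[OF Xc[of n] xc] by (simp add: XS)
        also have "\<dots> \<le> L * norm (integral {0..r} (\<lambda>t. \<bar>X n t - x t\<bar>))"
          using L by (intro mult_left_mono) auto
        finally show ?thesis by (simp add: mult.commute)
      qed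
      then show "\<forall>\<^sub>F n in sequentially. norm (X (Suc n) r - \<Phi> x r) \<le> norm (integral {0..r} (\<lambda>t. \<bar>X n t - x t\<bar>)) * L"
        by (rule always_eventually[OF allI])
    qed
  qed
  with xc show ?thesis by blast
qed

section \<open>Slope and sine of the inclination angle\<close>

text \<open>If \<open>p = tan \<theta>\<close>, then \<open>sine_of_slope p = sin \<theta>\<close>, and \<open>slope_of_sine\<close> is the inverse.  The sine is the
  unknown in which the equation takes divergence form.\<close>
definition sine_of_slope :: "real \<Rightarrow> real" where
  "sine_of_slope p = p / sqrt (1 + p\<^sup>2)"

definition slope_of_sine :: "real \<Rightarrow> real" where
  "slope_of_sine s = s / sqrt (1 - s\<^sup>2)"

lemma sqrt_one_plus_square_pos: "sqrt (1 + (p::real)\<^sup>2) > 0"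
  by (simp add: add_pos_nonneg)

lemma slope_of_sine_of_slope [simp]: "slope_of_sine (sine_of_slope p) = p"
proof -
  have pos: "1 + p\<^sup>2 > 0" by (simp add: add_pos_nonneg)
  have "1 - (p / sqrt (1 + p\<^sup>2))\<^sup>2 = 1 / (1 + p\<^sup>2)"
    using pos by (simp add: power_divide field_simps)
  then show ?thesis
    using pos by (simp add: slope_of_sine_def sine_of_slope_def real_sqrt_divide)
qed

lemma sine_of_slope_of_sine:
  assumes "\<bar>s\<bar> < 1" shows "sine_of_slope (slope_of_sine s) = s"
proof -
  have pos: "1 - s\<^sup>2 > 0" using assms by (simp add: abs_square_less_1)
  have "1 + (s / sqrt (1 - s\<^sup>2))\<^sup>2 = 1 / (1 - s\<^sup>2)"
    using pos by (simp add: power_divide field_simps)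
  then show ?thesis
    using pos by (simp add: slope_of_sine_def sine_of_slope_def real_sqrt_divide)
qed

lemma abs_sine_of_slope_less_1: "\<bar>sine_of_slope p\<bar> < 1"
proof -
  have "\<bar>p\<bar> < sqrt (1 + p\<^sup>2)" by (rule real_less_rsqrt) simp
  then show ?thesis using sqrt_one_plus_square_pos[of p] by (simp add: sine_of_slope_def abs_divide)
qed

lemma continuous_on_sine_of_slope [continuous_intros]:
  "continuous_on A f \<Longrightarrow> continuous_on A (\<lambda>x. sine_of_slope (f x))"
  unfolding sine_of_slope_def
  by (intro continuous_intros) (use sqrt_one_plus_square_pos in \<open>auto simp: less_le\<close>)

lemma DERIV_sine_of_slope:
  assumes "(p has_real_derivative p') (at r)"
  shows "((\<lambda>r. sine_of_slope (p r)) has_real_derivative p' / ((1 + (p r)\<^sup>2) * sqrt (1 + (p r)\<^sup>2))) (at r)"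
proof -
  define w where "w = sqrt (1 + (p r)\<^sup>2)"
  have w: "w > 0" "w\<^sup>2 = 1 + (p r)\<^sup>2" using sqrt_one_plus_square_pos by (auto simp: w_def)
  have pos: "1 + (p r)\<^sup>2 > 0" using w by (metis zero_less_power)
  have "((\<lambda>r. sine_of_slope (p r)) has_real_derivative
     (p' * w - p r * (2 * p r * p' / (2 * w))) / (w * w)) (at r)"
    unfolding sine_of_slope_def
    by (auto intro!: derivative_eq_intros assms simp: w_def[symmetric]) (use w pos in \<open>auto simp: w_def field_simps\<close>)
  also have "(p' * w - p r * (2 * p r * p' / (2 * w))) / (w * w) = p' * (w\<^sup>2 - (p r)\<^sup>2) / (w\<^sup>2 * w)"
    using w(1) by (simp add: field_simps power2_eq_square)
  also have "\<dots> = p' / ((1 + (p r)\<^sup>2) * w)" by (simp add: w(2))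
  finally show ?thesis by (simp add: w_def)
qed

lemma DERIV_slope_of_sine:
  assumes "(s has_real_derivative s') (at r)" "\<bar>s r\<bar> < 1"
  shows "((\<lambda>r. slope_of_sine (s r)) has_real_derivative s' / ((1 - (s r)\<^sup>2) * sqrt (1 - (s r)\<^sup>2))) (at r)"
proof -
  define w where "w = sqrt (1 - (s r)\<^sup>2)"
  have w: "w > 0" "w\<^sup>2 = 1 - (s r)\<^sup>2" "(s r)\<^sup>2 < 1" using assms(2) by (auto simp: w_def abs_square_less_1 less_imp_le)
  have "((\<lambda>r. slope_of_sine (s r)) has_real_derivative
     (s' * w + s r * (2 * s r * s' / (2 * w))) / (w * w)) (at r)"
    unfolding slope_of_sine_def
    by (auto intro!: derivative_eq_intros assms simp: w_def[symmetric]) (use w in \<open>auto simp: w_def field_simps\<close>)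
  also have "(s' * w + s r * (2 * s r * s' / (2 * w))) / (w * w) = s' * (w\<^sup>2 + (s r)\<^sup>2) / (w\<^sup>2 * w)"
    using w(1) by (simp add: field_simps power2_eq_square)
  also have "\<dots> = s' / ((1 - (s r)\<^sup>2) * w)" by (simp add: w(2))
  finally show ?thesis by (simp add: w_def)
qed

lemma slope_of_sine_mono:
  assumes "0 \<le> a" "a \<le> b" "b < 1"
  shows "slope_of_sine a \<le> slope_of_sine b"
proof -
  have "a\<^sup>2 \<le> b\<^sup>2" using assms by (simp add: power_mono)
  moreover have "b\<^sup>2 < 1" using assms by (simp add: abs_square_less_1)
  ultimately show ?thesis unfolding slope_of_sine_def using assms by (intro frac_le) auto
qed

lemma sine_of_slope_nonneg: "p \<ge> 0 \<Longrightarrow> sine_of_slope p \<ge> 0"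
  by (simp add: sine_of_slope_def)

lemma sine_of_slope_mono:
  assumes "0 \<le> p" "p \<le> q" shows "sine_of_slope p \<le> sine_of_slope q"
proof (rule ccontr)
  assume *: "\<not> ?thesis"
  then have "slope_of_sine (sine_of_slope q) \<le> slope_of_sine (sine_of_slope p)"
    using assms abs_sine_of_slope_less_1[of p] by (intro slope_of_sine_mono) (auto simp: sine_of_slope_nonneg)
  then show False using assms * by simp
qed

lemma continuous_on_slope_of_sine:
  assumes "continuous_on A f" "\<And>x. x \<in> A \<Longrightarrow> \<bar>f x\<bar> < 1"
  shows "continuous_on A (\<lambda>x. slope_of_sine (f x))"
proof -
  have "sqrt (1 - (f x)\<^sup>2) \<noteq> 0" if "x \<in> A" for x
    using assms(2)[OF that] abs_square_less_1[of "f x"] by auto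
  then show ?thesis unfolding slope_of_sine_def by (intro continuous_intros assms) auto
qed

lemma slope_of_sine_lipschitz:
  assumes "c < 1" "a \<in> {0..c}" "b \<in> {0..c}"
  shows "\<bar>slope_of_sine a - slope_of_sine b\<bar> \<le> 1 / ((1 - c\<^sup>2) * sqrt (1 - c\<^sup>2)) * \<bar>a - b\<bar>"
proof -
  have c: "c\<^sup>2 < 1" using assms by (simp add: abs_square_less_1)
  have "norm (slope_of_sine a - slope_of_sine b) \<le> 1 / ((1 - c\<^sup>2) * sqrt (1 - c\<^sup>2)) * norm (a - b)"
  proof (rule field_differentiable_bound[where f' = "\<lambda>x. 1 / ((1 - x\<^sup>2) * sqrt (1 - x\<^sup>2))", OF convex_real_interval(5)])
    fix x assume x: "x \<in> {0..c}"
    show "(slope_of_sine has_field_derivative 1 / ((1 - x\<^sup>2) * sqrt (1 - x\<^sup>2))) (at x within {0..c})"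
      using DERIV_slope_of_sine[OF DERIV_ident, of x] x assms(1)
      by (auto intro: has_field_derivative_at_within)
    have "x\<^sup>2 \<le> c\<^sup>2" using x by (simp add: power_mono)
    then have "(1 - c\<^sup>2) * sqrt (1 - c\<^sup>2) \<le> (1 - x\<^sup>2) * sqrt (1 - x\<^sup>2)"
      using c by (intro mult_mono) auto
    moreover have "(1 - c\<^sup>2) * sqrt (1 - c\<^sup>2) > 0" using c by simp
    ultimately show "norm (1 / ((1 - x\<^sup>2) * sqrt (1 - x\<^sup>2))) \<le> 1 / ((1 - c\<^sup>2) * sqrt (1 - c\<^sup>2))"
      by (simp add: frac_le)
  qed (use assms in auto)
  then show ?thesis by simp
qed

lemma sqrt_one_plus_square_lipschitz: "\<bar>sqrt (1 + p\<^sup>2) - sqrt (1 + q\<^sup>2)\<bar> \<le> \<bar>p - q\<bar>"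
proof -
  define a b where "a = sqrt (1 + p\<^sup>2)" and "b = sqrt (1 + q\<^sup>2)"
  have ab: "a > 0" "b > 0" "a\<^sup>2 = 1 + p\<^sup>2" "b\<^sup>2 = 1 + q\<^sup>2"
    using sqrt_one_plus_square_pos by (auto simp: a_def b_def add_nonneg_nonneg)
  have "\<bar>p\<bar> \<le> a" "\<bar>q\<bar> \<le> b" by (auto simp: a_def b_def intro: real_le_rsqrt)
  then have "\<bar>p + q\<bar> \<le> a + b" by linarith
  have "\<bar>a - b\<bar> * (a + b) = \<bar>a\<^sup>2 - b\<^sup>2\<bar>"
  proof -
    have "\<bar>a\<^sup>2 - b\<^sup>2\<bar> = \<bar>(a - b) * (a + b)\<bar>" by (simp add: power2_eq_square algebra_simps)
    then show ?thesis using ab(1,2) by (simp add: abs_mult)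
  qed
  also have "\<dots> = \<bar>p - q\<bar> * \<bar>p + q\<bar>"
    unfolding ab abs_mult[symmetric] by (simp add: power2_eq_square algebra_simps)
  also have "\<dots> \<le> \<bar>p - q\<bar> * (a + b)"
    using \<open>\<bar>p + q\<bar> \<le> a + b\<close> by (simp add: mult_left_mono)
  finally have "\<bar>a - b\<bar> \<le> \<bar>p - q\<bar>"
    by (rule mult_right_le_imp_le) (use ab in simp)
  then show ?thesis by (simp add: a_def b_def)
qed

section \<open>The equation and its profiles\<close>

text \<open>Here \<open>k\<close> stands for \<open>n - 1\<close>.\<close>
locale expander_params =
  fixes k :: nat and lam \<mu> :: real
  assumes k: "k \<ge> 1" and lamk: "lam * k > 1" and mu: "\<mu> < 0"
begin

lemma lam_pos: "lam > 0"
  using lamk k by (metis less_numeral_extra(1) of_nat_0_le_iff order_less_trans zero_less_mult_pos2 linorder_not_less mult_nonpos_nonneg order.strict_trans1)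

lemma k_nonzero [simp]: "k \<noteq> 0"
  using k by simp

text \<open>\<open>slope_rate r y p\<close> is the value that the equation prescribes for the second derivative at radius \<open>r\<close>, height
  \<open>y\<close> and slope \<open>p\<close>.\<close>
definition slope_rate :: "real \<Rightarrow> real \<Rightarrow> real \<Rightarrow> real" where
  "slope_rate r y p = (1 + p\<^sup>2)\<^sup>2 / (lam * (r * p - y)) - k / r * (1 + p\<^sup>2) * p"

text \<open>The right hand side, without the factor \<open>r ^ k\<close>, of the equation in divergence form.\<close>
definition flux_density :: "real \<Rightarrow> real \<Rightarrow> real \<Rightarrow> real" where
  "flux_density r y p = sqrt (1 + p\<^sup>2) / (lam * (r * p - y))"

text \<open>A solution on \<open>{0..<R}\<close>, with the slope \<open>p\<close> carried as a separate function.  The interval is half open, so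
  that all derivatives are two-sided and the notion applies up to a radius at which a cut-off may set in.
  The gap is required to be positive at \<open>0\<close> too, where it equals \<open>- \<mu>\<close>.\<close>
definition profile_on :: "real \<Rightarrow> (real \<Rightarrow> real) \<Rightarrow> (real \<Rightarrow> real) \<Rightarrow> bool" where
  "profile_on R f p \<longleftrightarrow> f 0 = \<mu> \<and> p 0 = 0 \<and> continuous_on {0..<R} f \<and> continuous_on {0..<R} p \<and>
     (\<forall>r\<in>{0<..<R}. (f has_real_derivative p r) (at r) \<and> (p has_real_derivative slope_rate r (f r) (p r)) (at r)) \<and>
     (\<forall>r\<in>{0..<R}. r * p r - f r > 0)"

text \<open>This is \<open>(1 + r / (- \<mu>)) powr (1 / (lam k - 1))\<close>; it turns out to bound \<open>sqrt (1 + p\<^sup>2)\<close>.\<close>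
definition slope_bound :: "real \<Rightarrow> real" where
  "slope_bound r = exp (ln (1 + r / - \<mu>) / (lam * k - 1))"

text \<open>The divergence form of the equation: differentiating \<open>r ^ k\<close> produces exactly the term that cancels the
  singular friction term \<open>k / r * (1 + p\<^sup>2) * p\<close>.\<close>
lemma DERIV_flux:
  assumes r: "r > 0" and p: "(p has_real_derivative slope_rate r y (p r)) (at r)"
  shows "((\<lambda>r. r ^ k * sine_of_slope (p r)) has_real_derivative r ^ k * flux_density r y (p r)) (at r)"
proof -
  define w where "w = sqrt (1 + (p r)\<^sup>2)"
  have w: "w > 0" "1 + (p r)\<^sup>2 = w\<^sup>2" using sqrt_one_plus_square_pos by (auto simp: w_def add_nonneg_nonneg)
  have rk: "r ^ k = r * r ^ (k - 1)" using k by (cases k) auto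
  have "((\<lambda>r. r ^ k * sine_of_slope (p r)) has_real_derivative
      k * r ^ (k - 1) * sine_of_slope (p r) + slope_rate r y (p r) / ((1 + (p r)\<^sup>2) * sqrt (1 + (p r)\<^sup>2)) * r ^ k) (at r)"
    by (rule DERIV_mult[OF _ DERIV_sine_of_slope[OF p], of "\<lambda>r. r ^ k"]) (use DERIV_pow[of k r UNIV] in simp)
  also have "k * r ^ (k - 1) * sine_of_slope (p r) + slope_rate r y (p r) / ((1 + (p r)\<^sup>2) * sqrt (1 + (p r)\<^sup>2)) * r ^ k
      = r ^ k * flux_density r y (p r)"
  proof -
    define G where "G = lam * (r * p r - y)"
    show ?thesis
      unfolding slope_rate_def flux_density_def sine_of_slope_def w_def[symmetric] w(2) rk G_def[symmetric]
      using w(1) r by (cases "G = 0") (simp_all add: field_simps power2_eq_square)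
  qed
  finally show ?thesis .
qed

section \<open>A priori bounds\<close>

context
  fixes R f p assumes prof: "profile_on R f p"
begin

lemma profile_onD:
  "f 0 = \<mu>" "p 0 = 0" "continuous_on {0..<R} f" "continuous_on {0..<R} p"
  "\<And>r. 0 < r \<Longrightarrow> r < R \<Longrightarrow> (f has_real_derivative p r) (at r)"
  "\<And>r. 0 < r \<Longrightarrow> r < R \<Longrightarrow> (p has_real_derivative slope_rate r (f r) (p r)) (at r)"
  "\<And>r. 0 \<le> r \<Longrightarrow> r < R \<Longrightarrow> r * p r - f r > 0"
  using prof by (auto simp: profile_on_def)

lemma continuous_on_sub:
  assumes "b < R" "a \<ge> 0"
  shows "continuous_on {a..b} f" "continuous_on {a..b} p"
  using assms by (auto intro!: continuous_on_subset[OF profile_onD(3)] continuous_on_subset[OF profile_onD(4)])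

lemma flux_density_pos: "0 \<le> r \<Longrightarrow> r < R \<Longrightarrow> flux_density r (f r) (p r) > 0"
  using profile_onD(7)[of r] lam_pos sqrt_one_plus_square_pos[of "p r"] by (simp add: flux_density_def)

lemma continuous_on_flux_density: "continuous_on {0..<R} (\<lambda>r. flux_density r (f r) (p r))"
proof -
  have "lam * (r * p r - f r) \<noteq> 0" if "r \<in> {0..<R}" for r
    using profile_onD(7)[of r] lam_pos that by auto
  then show ?thesis
    unfolding flux_density_def by (intro continuous_intros profile_onD) auto
qed

text \<open>The flux \<open>r ^ k * sine_of_slope (p r)\<close> vanishes at \<open>0\<close> and has positive derivative.\<close>
lemma slope_pos:
  assumes "0 < r" "r < R" shows "p r > 0"
proof -
  have "0 ^ k * sine_of_slope (p 0) < r ^ k * sine_of_slope (p r)"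
  proof (rule DERIV_pos_imp_increasing_open[OF assms(1)])
    fix x assume x: "0 < x" "x < r"
    have "x ^ k * flux_density x (f x) (p x) > 0" using x flux_density_pos[of x] assms by simp
    then show "\<exists>y. ((\<lambda>r. r ^ k * sine_of_slope (p r)) has_real_derivative y) (at x) \<and> y > 0"
      using DERIV_flux[OF x(1) profile_onD(6)] x assms by auto
  qed (intro continuous_intros continuous_on_sub assms; simp)
  then have "sine_of_slope (p r) > 0"
    using assms by (simp add: zero_less_mult_iff power_0_left)
  then show ?thesis using sqrt_one_plus_square_pos[of "p r"] by (simp add: sine_of_slope_def zero_less_divide_iff)
qed

text \<open>The slope increases exactly where the excess is positive.\<close>
definition excess :: "real \<Rightarrow> real" where
  "excess r = r * (1 + (p r)\<^sup>2) - lam * k * p r * (r * p r - f r)"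

lemma slope_rate_eq_excess:
  assumes "0 < r" "r < R"
  shows "slope_rate r (f r) (p r) = (1 + (p r)\<^sup>2) * excess r / (lam * r * (r * p r - f r))"
  using profile_onD(7)[of r] lam_pos assms
  unfolding slope_rate_def excess_def by (simp add: divide_simps) (simp add: algebra_simps power2_eq_square)

text \<open>Let \<open>m\<close> be the flux density, which is continuous at \<open>0\<close> with \<open>m 0 > 0\<close>.  Integrating the divergence form gives
  \<open>sine_of_slope (p r) \<approx> m 0 * r / (k + 1)\<close>, hence \<open>r m - k sine_of_slope p \<approx> m 0 * r / (k + 1) > 0\<close>,
  and the left hand side is a positive multiple of the excess.  The limit is replaced by
  estimates with a relative error \<open>e\<close> so small that \<open>(1 + e) k < (1 - e) (k + 1)\<close>.\<close>
lemma excess_pos_near_0: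
  assumes "R > 0"
  obtains d where "0 < d" "d < R" "\<And>r. 0 < r \<Longrightarrow> r \<le> d \<Longrightarrow> excess r > 0"
proof -
  define m where "m r = flux_density r (f r) (p r)" for r
  \<comment> \<open>Any \<open>e\<close> with \<open>0 < e < 1 / (2 k + 1)\<close> satisfies the second inequality.\<close>
  define e where "e = 1 / (2 * real k + 2)"
  have e: "e > 0" "(1 + e) * k < (1 - e) * (k + 1)" by (auto simp: e_def field_simps)
  have m0: "m 0 > 0" using flux_density_pos[of 0] assms by (simp add: m_def)
  have "continuous (at 0 within {0..<R}) m"
    using continuous_on_flux_density assms by (simp add: continuous_on_eq_continuous_within m_def[abs_def])
  then obtain d where d: "d > 0" "\<And>r. r \<in> {0..<R} \<Longrightarrow> \<bar>r\<bar> < d \<Longrightarrow> \<bar>m r - m 0\<bar> < e * m 0"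
    unfolding continuous_within_eps_delta dist_real_def using e(1) m0 by (metis diff_zero mult_pos_pos)
  have "excess r > 0" if r: "0 < r" "r \<le> min (d / 2) (R / 2)" for r
  proof -
    have lt: "r < d" "r < R" using r d(1) assms by auto
    have rk: "r ^ k * sine_of_slope (p r) - (1 + e) * m 0 / (k + 1) * r ^ (k + 1) \<le>
          0 ^ k * sine_of_slope (p 0) - (1 + e) * m 0 / (k + 1) * 0 ^ (k + 1)"
    proof (rule DERIV_nonpos_imp_decreasing_open[OF less_imp_le[OF r(1)]])
      fix x assume x: "0 < x" "x < r"
      have "((\<lambda>r. r ^ k * sine_of_slope (p r)) has_real_derivative x ^ k * m x) (at x)"
        unfolding m_def using x lt by (intro DERIV_flux profile_onD) auto
      moreover have "((\<lambda>r. (1 + e) * m 0 / (k + 1) * r ^ (k + 1)) has_real_derivative (1 + e) * m 0 * x ^ k) (at x)"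
        using DERIV_cmult[OF DERIV_pow[of "k + 1" x UNIV], of "(1 + e) * m 0 / (k + 1)"]
        by (rule DERIV_cong) simp
      ultimately have "((\<lambda>r. r ^ k * sine_of_slope (p r) - (1 + e) * m 0 / (k + 1) * r ^ (k + 1)) has_real_derivative
         x ^ k * m x - (1 + e) * m 0 * x ^ k) (at x)"
        by (rule DERIV_diff)
      moreover have "x ^ k * m x - (1 + e) * m 0 * x ^ k \<le> 0"
      proof -
        have "m x \<le> (1 + e) * m 0" using d(2)[of x] x lt by (auto simp: algebra_simps)
        then show ?thesis using mult_left_mono[of "m x" "(1 + e) * m 0" "x ^ k"] x by (simp add: algebra_simps)
      qed
      ultimately show "\<exists>y. ((\<lambda>r. r ^ k * sine_of_slope (p r) - (1 + e) * m 0 / (k + 1) * r ^ (k + 1)) has_real_derivative y) (at x) \<and> y \<le> 0"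
        by blast
    qed (intro continuous_intros continuous_on_sub; use lt in simp)
    have "r ^ k * sine_of_slope (p r) \<le> r ^ k * ((1 + e) * m 0 * r / (k + 1))"
      using rk by (simp add: power_0_left algebra_simps)
    then have "sine_of_slope (p r) \<le> (1 + e) * m 0 * r / (k + 1)"
      by (rule mult_left_le_imp_le) (use r in simp)
    then have "k * sine_of_slope (p r) \<le> k * ((1 + e) * m 0 * r / (k + 1))" by (rule mult_left_mono) simp
    also have "\<dots> = ((1 + e) * k) * (m 0 * r / (k + 1))" by simp
    also have "\<dots> < ((1 - e) * (k + 1)) * (m 0 * r / (k + 1))"
      using e(2) m0 r by (intro mult_strict_right_mono) auto
    also have "\<dots> = r * ((1 - e) * m 0)" by simp
    also have "\<dots> < r * m r"
      using d(2)[of r] r lt by (intro mult_strict_left_mono) (auto simp: algebra_simps)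
    finally have "r * m r - k * sine_of_slope (p r) > 0" by simp
    moreover have "r * m r - k * sine_of_slope (p r) = excess r / (lam * (r * p r - f r) * sqrt (1 + (p r)\<^sup>2))"
    proof -
      define w where "w = sqrt (1 + (p r)\<^sup>2)"
      have w: "w > 0" "1 + (p r)\<^sup>2 = w\<^sup>2" using sqrt_one_plus_square_pos by (auto simp: w_def add_nonneg_nonneg)
      define g where "g = r * p r - f r"
      have "g > 0" using profile_onD(7)[of r] r lt by (simp add: g_def)
      then show ?thesis
        unfolding m_def flux_density_def excess_def sine_of_slope_def w_def[symmetric] w(2) g_def[symmetric]
        using w(1) lam_pos by (simp add: field_simps power2_eq_square)
    qed
    moreover have "lam * (r * p r - f r) * sqrt (1 + (p r)\<^sup>2) > 0"
      using profile_onD(7)[of r] lam_pos r lt sqrt_one_plus_square_pos by (intro mult_pos_pos) auto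
    ultimately show ?thesis by (simp add: zero_less_divide_iff)
  qed
  then show ?thesis using that[of "min (d / 2) (R / 2)"] d assms by auto
qed

lemma continuous_on_excess: "continuous_on {0..<R} excess"
  unfolding excess_def[abs_def] by (intro continuous_intros profile_onD)

text \<open>At a zero of the excess the slope and the gap are stationary, so only the explicit factor \<open>r\<close>
  contributes to the derivative.\<close>
lemma DERIV_excess_at_zero:
  assumes "0 < r" "r < R" "excess r = 0"
  shows "(excess has_real_derivative 1 + (p r)\<^sup>2) (at r)"
proof -
  have p: "(p has_real_derivative 0) (at r)"
    using profile_onD(6)[OF assms(1,2)] slope_rate_eq_excess[OF assms(1,2)] assms(3) by simp
  show ?thesis unfolding excess_def[abs_def]
    by (auto intro!: derivative_eq_intros p profile_onD(5) assms)
qed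

text \<open>At the first zero \<open>z\<close> after the initial interval the excess would have a positive derivative, so it would
  already be negative just before \<open>z\<close>.\<close>
lemma excess_pos:
  assumes "0 < r" "r < R" shows "excess r > 0"
proof (rule ccontr)
  assume neg: "\<not> excess r > 0"
  obtain d where d: "0 < d" "d < R" "\<And>r. 0 < r \<Longrightarrow> r \<le> d \<Longrightarrow> excess r > 0"
    using excess_pos_near_0 assms by (metis order.strict_trans)
  \<comment> \<open>The initial interval is cut away so that the set of violations is closed and has a least element.\<close>
  define B where "B = {x \<in> {d..r}. excess x \<le> 0}"
  have "d < r" using d(3)[of r] neg assms by fastforce
  have "continuous_on {d..r} excess"
    by (rule continuous_on_subset[OF continuous_on_excess]) (use d assms in auto)
  then have "closed B" unfolding B_def by (intro continuous_on_closed_Collect_le continuous_intros) auto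
  moreover have "r \<in> B" using \<open>d < r\<close> neg by (simp add: B_def)
  moreover have bdd: "bdd_below B" unfolding B_def by (auto intro!: bdd_belowI[of _ d])
  ultimately have inB: "Inf B \<in> B" using closed_contains_Inf[of B] by blast
  define z where "z = Inf B"
  have z: "z \<in> {d..r}" "excess z \<le> 0" using inB by (auto simp: z_def B_def)
  have first: "x \<ge> z" if "x \<in> {d..r}" "excess x \<le> 0" for x
    unfolding z_def using that by (intro cInf_lower bdd) (auto simp: B_def)
  have "d < z" using z d(3)[of z] d(1) by (cases "z = d") auto
  have "continuous_on {d..z} excess"
    by (rule continuous_on_subset[OF continuous_on_excess]) (use d assms z in auto)
  then have "\<exists>x. d \<le> x \<and> x \<le> z \<and> excess x = 0"
    by (intro IVT2' z(2) less_imp_le[OF d(3)] less_imp_le[OF \<open>d < z\<close>] d(1) order_refl)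
  then obtain x where "d \<le> x" "x \<le> z" "excess x = 0" by blast
  then have "excess z = 0" using first[of x] z by auto
  then have "(excess has_real_derivative 1 + (p z)\<^sup>2) (at z)"
    using z d assms by (intro DERIV_excess_at_zero) auto
  moreover have "1 + (p z)\<^sup>2 > 0" by (simp add: add_pos_nonneg)
  ultimately obtain h where h: "h > 0" "\<And>y. 0 < y \<Longrightarrow> y < h \<Longrightarrow> excess (z - y) < excess z"
    using DERIV_pos_inc_left by blast
  define y where "y = min (h / 2) ((z - d) / 2)"
  have y0: "0 < y" using h(1) \<open>d < z\<close> by (simp add: y_def)
  have "y \<le> h / 2" "y \<le> (z - d) / 2"
    unfolding y_def by (rule min.cobounded1, rule min.cobounded2)
  with y0 z(1) h(1) have y: "y < h" "z - y \<in> {d..r}" by auto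
  have "excess (z - y) < 0" using h(2)[OF y0 y(1)] \<open>excess z = 0\<close> by simp
  with first[OF y(2)] y0 show False by linarith
qed

lemma slope_rate_pos:
  assumes "0 < r" "r < R" shows "slope_rate r (f r) (p r) > 0"
  using excess_pos[OF assms] slope_rate_eq_excess[OF assms] profile_onD(7)[of r] lam_pos assms
  by (simp add: add_pos_nonneg)

lemma DERIV_gap:
  assumes "0 < r" "r < R"
  shows "((\<lambda>r. r * p r - f r) has_real_derivative r * slope_rate r (f r) (p r)) (at r)"
  by (auto intro!: derivative_eq_intros profile_onD(5,6) assms)

lemma gap_lower_bound:
  assumes "0 \<le> r" "r < R" shows "r * p r - f r \<ge> - \<mu>"
proof -
  have "0 * p 0 - f 0 \<le> r * p r - f r"
  proof (rule DERIV_nonneg_imp_increasing_open[OF assms(1)])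
    fix x assume x: "0 < x" "x < r"
    then have "x * slope_rate x (f x) (p x) \<ge> 0" using slope_rate_pos[of x] assms by (simp add: less_imp_le)
    then show "\<exists>y. ((\<lambda>r. r * p r - f r) has_real_derivative y) (at x) \<and> 0 \<le> y"
      using DERIV_gap[of x] x assms by auto
  qed (intro continuous_intros continuous_on_sub; use assms in simp)
  then show ?thesis by (simp add: profile_onD)
qed

lemma height_lower_bound:
  assumes "0 \<le> r" "r < R" shows "f r \<ge> \<mu>"
proof -
  have "f 0 \<le> f r"
  proof (rule DERIV_nonneg_imp_increasing_open[OF assms(1)])
    fix x assume x: "0 < x" "x < r"
    then show "\<exists>y. (f has_real_derivative y) (at x) \<and> 0 \<le> y"
      using profile_onD(5)[of x] slope_pos[of x] assms by (intro exI[of _ "p x"]) auto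
  qed (intro continuous_on_sub; use assms in simp)
  then show ?thesis by (simp add: profile_onD)
qed

text \<open>The difference of the two sides has derivative \<open>p' (r / g - lam k p / (1 + p\<^sup>2))\<close>, which is
  \<open>p' E / (g (1 + p\<^sup>2))\<close> with \<open>E\<close> the excess, a product of positive factors.\<close>
lemma gap_dominates_slope:
  assumes r: "0 \<le> r" "r < R"
  shows "ln (r * p r - f r) \<ge> lam * k / 2 * ln (1 + (p r)\<^sup>2) + ln (- \<mu>)"
proof -
  have pos: "1 + (p x)\<^sup>2 > 0" for x by (simp add: add_pos_nonneg)
  have "ln (0 * p 0 - f 0) - lam * k / 2 * ln (1 + (p 0)\<^sup>2) \<le> ln (r * p r - f r) - lam * k / 2 * ln (1 + (p r)\<^sup>2)"
  proof (rule DERIV_nonneg_imp_increasing_open[OF assms(1)])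
    fix x assume x: "0 < x" "x < r"
    define g c where "g = x * p x - f x" and "c = slope_rate x (f x) (p x)"
    have g: "g > 0" using profile_onD(7)[of x] x r by (simp add: g_def)
    have d1: "((\<lambda>r. ln (r * p r - f r)) has_real_derivative x * c / g) (at x)"
      unfolding g_def c_def using DERIV_chain2[OF DERIV_ln_divide DERIV_gap, of x] x r g
      by (simp add: g_def)
    have "((\<lambda>r. 1 + (p r)\<^sup>2) has_real_derivative 2 * p x * c) (at x)"
      unfolding c_def using x r by (auto intro!: derivative_eq_intros profile_onD)
    from DERIV_chain2[OF DERIV_ln_divide[OF pos] this]
    have d2: "((\<lambda>r. ln (1 + (p r)\<^sup>2)) has_real_derivative 2 * p x * c / (1 + (p x)\<^sup>2)) (at x)" by simp
    have "((\<lambda>r. ln (r * p r - f r) - lam * k / 2 * ln (1 + (p r)\<^sup>2)) has_real_derivative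
       x * c / g - lam * k / 2 * (2 * p x * c / (1 + (p x)\<^sup>2))) (at x)"
      by (rule DERIV_diff[OF d1 DERIV_cmult[OF d2]])
    moreover have "x * c / g - lam * k / 2 * (2 * p x * c / (1 + (p x)\<^sup>2)) = c * excess x / (g * (1 + (p x)\<^sup>2))"
    proof -
      define v where "v = 1 + (p x)\<^sup>2"
      have "v > 0" using pos[of x] by (simp add: v_def)
      then show ?thesis
        using g unfolding excess_def g_def[symmetric] v_def[symmetric] by (simp add: field_simps)
    qed
    moreover have "c * excess x / (g * (1 + (p x)\<^sup>2)) \<ge> 0"
    proof -
      have "c > 0" "excess x > 0" using slope_rate_pos[of x] excess_pos[of x] x r by (simp_all add: c_def)
      then show ?thesis using g pos[of x] by simp
    qed
    ultimately show "\<exists>y. ((\<lambda>r. ln (r * p r - f r) - lam * k / 2 * ln (1 + (p r)\<^sup>2)) has_real_derivative y) (at x) \<and> 0 \<le> y"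
      by (intro exI conjI) (assumption, simp)
  next
    have "r * p r - f r \<noteq> 0" if "r \<in> {0..<R}" for r using profile_onD(7)[of r] that by auto
    then show "continuous_on {0..r} (\<lambda>r. ln (r * p r - f r) - lam * k / 2 * ln (1 + (p r)\<^sup>2))"
      using r pos by (intro continuous_intros continuous_on_sub) (auto simp: less_le)
  qed
  then show ?thesis by (simp add: profile_onD)
qed

text \<open>With \<open>w = sqrt (1 + p\<^sup>2)\<close>, the lower bound \<open>(- \<mu>) w powr (lam k) \<le> g\<close> is played off against the upper
  bound \<open>g \<le> (r - \<mu>) w\<close>, which follows from \<open>f \<ge> \<mu>\<close> and \<open>p \<le> w\<close>.  This is the step where the size of
  \<open>lam\<close> matters: \<open>w powr (lam k - 1)\<close> is bounded only because the exponent is positive.\<close>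
lemma slope_bound_sq:
  assumes r: "0 \<le> r" "r < R"
  shows "1 + (p r)\<^sup>2 \<le> (slope_bound r)\<^sup>2"
proof -
  define w where "w = sqrt (1 + (p r)\<^sup>2)"
  have w: "w > 0" "1 + (p r)\<^sup>2 = w\<^sup>2" "1 \<le> w" 
    using sqrt_one_plus_square_pos by (auto simp: w_def add_nonneg_nonneg)
  have "p r \<ge> 0" using slope_pos[of r] r profile_onD(2) by (cases "r = 0") (auto simp: less_imp_le)
  have "p r \<le> w" unfolding w_def by (rule real_le_rsqrt) simp
  have "r * p r - f r \<le> r * w + (- \<mu>) * w"
  proof -
    have "r * p r \<le> r * w" using \<open>p r \<le> w\<close> r by (simp add: mult_left_mono)
    moreover have "- \<mu> * 1 \<le> - \<mu> * w" using w mu by (intro mult_left_mono) auto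
    ultimately show ?thesis using height_lower_bound[OF r] by linarith
  qed
  also have "\<dots> = (- \<mu>) * (1 + r / - \<mu>) * w" using mu by (simp add: field_simps)
  finally have "ln (r * p r - f r) \<le> ln ((- \<mu>) * (1 + r / - \<mu>) * w)"
    using profile_onD(7)[OF r] by simp
  also have "\<dots> = ln (- \<mu>) + ln (1 + r / - \<mu>) + ln w"
  proof -
    have "0 < 1 + r / - \<mu>" using mu r by (simp add: add_pos_nonneg divide_nonneg_neg)
    then have "0 < (- \<mu>) * (1 + r / - \<mu>)" using mu by (intro mult_pos_pos) auto
    then show ?thesis
      using ln_mult_pos[of "(- \<mu>) * (1 + r / - \<mu>)" w] ln_mult_pos[of "- \<mu>" "1 + r / - \<mu>"] mu w \<open>0 < 1 + r / - \<mu>\<close>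
      by simp
  qed
  finally have "(lam * k - 1) * ln w \<le> ln (1 + r / - \<mu>)"
    using gap_dominates_slope[OF r] w by (simp add: ln_realpow algebra_simps)
  then have "ln w \<le> ln (1 + r / - \<mu>) / (lam * k - 1)"
    using lamk by (simp add: field_simps)
  then have "w \<le> slope_bound r"
    unfolding slope_bound_def using w by (metis exp_le_cancel_iff exp_ln)
  then show ?thesis using w by (simp add: power_mono)
qed

end
end

section \<open>The truncated integral operator\<close>

text \<open>The weight \<open>(t / r) ^ k\<close> is at most \<open>1\<close>, so the average with this weight is harmless at the singular
  point \<open>r = 0\<close>, where the left hand side is \<open>0\<close> by the convention on division by zero.\<close>
lemma weighted_average_bound:
  fixes \<phi> :: "real \<Rightarrow> real"
  assumes c: "continuous_on {0..r} \<phi>" and r: "r \<ge> 0"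
  shows "\<bar>integral {0..r} (\<lambda>t. t ^ k * \<phi> t) / r ^ k\<bar> \<le> integral {0..r} (\<lambda>t. \<bar>\<phi> t\<bar>)"
proof (cases "r = 0")
  case False
  with r have r: "r > 0" by simp
  have "\<bar>integral {0..r} (\<lambda>t. t ^ k * \<phi> t)\<bar> \<le> integral {0..r} (\<lambda>t. r ^ k * \<bar>\<phi> t\<bar>)"
    unfolding real_norm_def[symmetric]
  proof (rule integral_norm_bound_integral)
    show "norm (t ^ k * \<phi> t) \<le> r ^ k * norm (\<phi> t)" if "t \<in> {0..r}" for t
      using that by (simp add: abs_mult mult_right_mono power_mono)
  qed (intro integrable_continuous_interval continuous_intros c)+
  also have "\<dots> = r ^ k * integral {0..r} (\<lambda>t. \<bar>\<phi> t\<bar>)" by simp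
  finally show ?thesis using r by (simp add: abs_divide divide_le_eq mult.commute)
qed simp

context expander_params begin

lemma slope_bound_mono:
  assumes "0 \<le> s" "s \<le> t" shows "slope_bound s \<le> slope_bound t"
proof -
  have "s / - \<mu> \<le> t / - \<mu>" "0 \<le> s / - \<mu>" using assms mu by (auto simp: divide_right_mono field_simps)
  then have "ln (1 + s / - \<mu>) \<le> ln (1 + t / - \<mu>)" by (subst ln_le_cancel_iff) auto
  then show ?thesis using lamk unfolding slope_bound_def by (simp add: divide_right_mono)
qed

lemma slope_bound_ge_1: "0 \<le> t \<Longrightarrow> slope_bound t \<ge> 1"
  using slope_bound_mono[of 0 t] by (simp add: slope_bound_def)

lemma continuous_on_slope_bound: "continuous_on {0..} slope_bound"
proof -
  have "1 + t / - \<mu> \<noteq> 0" if "t \<ge> 0" for t using that mu by (simp add: field_simps)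
  then show ?thesis using mu lamk unfolding slope_bound_def by (intro continuous_intros) auto
qed

text \<open>Cutting off the sine at the value that corresponds to \<open>slope_bound\<close> keeps it away from \<open>1\<close>, where
  \<open>slope_of_sine\<close> is singular, uniformly on every bounded interval.\<close>
definition sine_bound :: "real \<Rightarrow> real" where
  "sine_bound t = sine_of_slope (slope_bound t)"

lemma sine_bound:
  assumes "0 \<le> t"
  shows "0 < sine_bound t" "sine_bound t < 1"
  using slope_bound_ge_1[OF assms] abs_sine_of_slope_less_1[of "slope_bound t"]
    sqrt_one_plus_square_pos[of "slope_bound t"]
  by (auto simp: sine_bound_def sine_of_slope_def intro!: divide_pos_pos)

definition cut_slope :: "real \<Rightarrow> real \<Rightarrow> real" where
  "cut_slope t s = slope_of_sine (max 0 (min s (sine_bound t)))"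

lemma cut_slope_bounds:
  assumes "0 \<le> t" shows "0 \<le> cut_slope t s" "cut_slope t s \<le> slope_bound t"
proof -
  show "cut_slope t s \<le> slope_bound t"
    using slope_of_sine_mono[of "max 0 (min s (sine_bound t))" "sine_bound t"] sine_bound[OF assms]
    by (simp add: cut_slope_def sine_bound_def)
  show "0 \<le> cut_slope t s"
    using slope_of_sine_mono[of 0 "max 0 (min s (sine_bound t))"] sine_bound[OF assms]
    by (auto simp: cut_slope_def slope_of_sine_def)
qed

lemma cut_slope_lipschitz:
  assumes "T \<ge> 0"
  obtains L where "L \<ge> 0" "\<And>t a b. 0 \<le> t \<Longrightarrow> t \<le> T \<Longrightarrow> \<bar>cut_slope t a - cut_slope t b\<bar> \<le> L * \<bar>a - b\<bar>"
proof -
  define c where "c = sine_bound T"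
  define L where "L = 1 / ((1 - c\<^sup>2) * sqrt (1 - c\<^sup>2))"
  have c: "0 \<le> c" "c < 1" using sine_bound[OF assms] by (auto simp: c_def)
  then have "c\<^sup>2 < 1" by (simp add: abs_square_less_1)
  then have L0: "L \<ge> 0" by (simp add: L_def)
  have "\<bar>cut_slope t a - cut_slope t b\<bar> \<le> L * \<bar>a - b\<bar>" if t: "0 \<le> t" "t \<le> T" for t a b
  proof -
    have le: "sine_bound t \<le> c"
      unfolding sine_bound_def c_def
      using t slope_bound_ge_1[OF t(1)] by (intro sine_of_slope_mono slope_bound_mono) auto
    have "\<bar>cut_slope t a - cut_slope t b\<bar> \<le> L * \<bar>max 0 (min a (sine_bound t)) - max 0 (min b (sine_bound t))\<bar>"
      unfolding cut_slope_def L_def using c le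
      by (intro slope_of_sine_lipschitz) (auto simp: le_max_iff_disj min_le_iff_disj)
    also have "\<dots> \<le> L * \<bar>a - b\<bar>"
      using L0 by (intro mult_left_mono) (auto simp: max_def min_def)
    finally show ?thesis .
  qed
  with L0 that show ?thesis by blast
qed

lemma cut_slope_inactive:
  assumes "0 \<le> s" "s \<le> sine_bound t" shows "cut_slope t s = slope_of_sine s"
  using assms by (simp add: cut_slope_def max_def min_def)

text \<open>The slope, height, gap and flux density that belong to a candidate \<open>S\<close> for the sine, with the cut-offs built
  in.  The lower cut-off of the gap is \<open>- \<mu> / 2\<close>, strictly below the a priori bound \<open>- \<mu>\<close>.\<close>
definition slope_at :: "(real \<Rightarrow> real) \<Rightarrow> real \<Rightarrow> real" where
  "slope_at S t = cut_slope t (S t)"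

definition height_at :: "(real \<Rightarrow> real) \<Rightarrow> real \<Rightarrow> real" where
  "height_at S t = \<mu> + integral {0..t} (slope_at S)"

definition gap_at :: "(real \<Rightarrow> real) \<Rightarrow> real \<Rightarrow> real" where
  "gap_at S t = max (- \<mu> / 2) (t * slope_at S t - height_at S t)"

definition flux_density_at :: "(real \<Rightarrow> real) \<Rightarrow> real \<Rightarrow> real" where
  "flux_density_at S t = sqrt (1 + (slope_at S t)\<^sup>2) / (lam * gap_at S t)"

definition flux_operator :: "(real \<Rightarrow> real) \<Rightarrow> real \<Rightarrow> real" where
  "flux_operator S r = integral {0..r} (\<lambda>t. t ^ k * flux_density_at S t) / r ^ k"

lemma gap_at_pos: "gap_at S t \<ge> - \<mu> / 2" "gap_at S t > 0"
  using mu by (auto simp: gap_at_def)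

context
  fixes S :: "real \<Rightarrow> real" assumes S: "continuous_on {0..} S"
begin

lemma continuous_on_slope_at: "continuous_on {0..} (slope_at S)"
  unfolding slope_at_def cut_slope_def
proof (rule continuous_on_slope_of_sine)
  show "continuous_on {0..} (\<lambda>t. max 0 (min (S t) (sine_bound t)))"
    unfolding sine_bound_def by (intro continuous_intros S continuous_on_slope_bound)
  show "\<bar>max 0 (min (S t) (sine_bound t))\<bar> < 1" if "t \<in> {0..}" for t
    using sine_bound[of t] that by (auto simp: max_def min_def)
qed

lemma height_at_derivative:
  assumes "0 \<le> r" "r \<le> T"
  shows "(height_at S has_real_derivative slope_at S r) (at r within {0..T})"
proof -
  have "continuous_on {0..T} (slope_at S)"
    by (rule continuous_on_subset[OF continuous_on_slope_at]) auto
  from integral_has_vector_derivative[OF this, of r] assms show ?thesis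
    unfolding height_at_def has_real_derivative_iff_has_vector_derivative
    by (auto intro!: derivative_eq_intros)
qed

lemma continuous_on_height_at: "continuous_on {0..} (height_at S)"
  by (rule continuous_on_atLeast0I) (rule DERIV_continuous_on[OF height_at_derivative], auto)

lemma continuous_on_flux_density_at: "continuous_on {0..} (flux_density_at S)"
proof -
  have "lam * gap_at S t \<noteq> 0" for t using gap_at_pos[of S t] lam_pos by simp
  moreover have "continuous_on {0..} (gap_at S)"
    unfolding gap_at_def by (intro continuous_intros continuous_on_slope_at continuous_on_height_at)
  ultimately show ?thesis
    unfolding flux_density_at_def by (intro continuous_intros continuous_on_slope_at) auto
qed

lemma flux_density_at_pos: "flux_density_at S t > 0"
  unfolding flux_density_at_def by (intro divide_pos_pos mult_pos_pos lam_pos gap_at_pos sqrt_one_plus_square_pos)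

lemma continuous_on_integrand: "continuous_on {0..T} (\<lambda>t. t ^ k * flux_density_at S t)"
  by (intro continuous_intros continuous_on_subset[OF continuous_on_flux_density_at]) auto

lemma flux_integral_derivative:
  assumes "0 \<le> r" "r \<le> T"
  shows "((\<lambda>r. integral {0..r} (\<lambda>t. t ^ k * flux_density_at S t)) has_real_derivative r ^ k * flux_density_at S r) (at r within {0..T})"
  using integral_has_vector_derivative[OF continuous_on_integrand, of r T] assms
  by (simp add: has_real_derivative_iff_has_vector_derivative)

lemma flux_operator_0 [simp]: "flux_operator S 0 = 0"
  by (simp add: flux_operator_def)

lemma flux_operator_nonneg: "r \<ge> 0 \<Longrightarrow> flux_operator S r \<ge> 0"
  unfolding flux_operator_def using flux_density_at_pos
  by (intro divide_nonneg_nonneg integral_nonneg integrable_continuous_interval continuous_on_integrand)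
    (auto simp: less_imp_le)

text \<open>Away from \<open>0\<close> this is a quotient of continuous functions.  At \<open>0\<close> the operator takes the value
  \<open>0\<close> and is dominated by the integral of the density.\<close>
lemma continuous_on_flux_operator: "continuous_on {0..} (flux_operator S)"
proof (rule continuous_on_atLeast0I)
  fix T
  show "continuous_on {0..T} (flux_operator S)"
    unfolding continuous_on_eq_continuous_within
  proof
    fix r assume r: "r \<in> {0..T}"
    show "continuous (at r within {0..T}) (flux_operator S)"
    proof (cases "r = 0")
      case False
      then show ?thesis
        unfolding flux_operator_def
        using r by (intro continuous_intros DERIV_continuous[OF flux_integral_derivative]) auto
    next
      case True
      have "((\<lambda>r. integral {0..r} (\<lambda>t. \<bar>flux_density_at S t\<bar>)) \<longlongrightarrow> integral {0..0} (\<lambda>t. \<bar>flux_density_at S t\<bar>)) (at 0 within {0..T})"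
      proof -
        have "continuous_on {0..T} (\<lambda>t. \<bar>flux_density_at S t\<bar>)"
          by (intro continuous_intros continuous_on_subset[OF continuous_on_flux_density_at]) auto
        then have "continuous_on {0..T} (\<lambda>r. integral {0..r} (\<lambda>t. \<bar>flux_density_at S t\<bar>))"
          by (intro indefinite_integral_continuous_1 integrable_continuous_interval)
        then show ?thesis using r unfolding True continuous_on_def by blast
      qed
      then have lim: "((\<lambda>r. integral {0..r} (\<lambda>t. \<bar>flux_density_at S t\<bar>)) \<longlongrightarrow> 0) (at 0 within {0..T})" by simp
      have "norm (flux_operator S r) \<le> integral {0..r} (\<lambda>t. \<bar>flux_density_at S t\<bar>)" if "r \<ge> 0" for r
        unfolding real_norm_def flux_operator_def
        by (rule weighted_average_bound) (use that in \<open>auto intro: continuous_on_subset[OF continuous_on_flux_density_at]\<close>)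
      then have "\<forall>\<^sub>F r in at 0 within {0..T}. norm (flux_operator S r) \<le> integral {0..r} (\<lambda>t. \<bar>flux_density_at S t\<bar>)"
        by (simp add: eventually_at_filter)
      then have "(flux_operator S \<longlongrightarrow> 0) (at 0 within {0..T})"
        using lim by (rule Lim_null_comparison)
      then show ?thesis using True by (simp add: continuous_within)
    qed
  qed
qed

end

text \<open>The slopes differ by at most \<open>L\<close> times the difference of the arguments, and the heights by at most \<open>L\<close>
  times its integral.  The flux density is a Lipschitz function of slope and gap, because the slope is at most
  \<open>slope_bound T\<close> and the gap at least \<open>- \<mu> / 2\<close>.  Integrating once more leaves only the integral of
  the difference.\<close>
lemma flux_operator_lipschitz:
  "\<exists>L\<ge>0. \<forall>x y r. continuous_on {0..} x \<longrightarrow> continuous_on {0..} y \<longrightarrow> 0 \<le> r \<longrightarrow> r \<le> T \<longrightarrow>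
      \<bar>flux_operator x r - flux_operator y r\<bar> \<le> L * integral {0..r} (\<lambda>t. \<bar>x t - y t\<bar>)"
proof (cases "T \<ge> 0")
  case False
  then show ?thesis by (intro exI[of _ 0]) auto
next
  case True
  obtain L where L: "L \<ge> 0" "\<And>t a b. 0 \<le> t \<Longrightarrow> t \<le> T \<Longrightarrow> \<bar>cut_slope t a - cut_slope t b\<bar> \<le> L * \<bar>a - b\<bar>"
    using cut_slope_lipschitz[OF True] by blast
  define m W where "m = - \<mu> / 2" and "W = sqrt (1 + (slope_bound T)\<^sup>2)"
  have m: "m > 0" using mu by (simp add: m_def)
  have W: "W > 0" unfolding W_def by (rule sqrt_one_plus_square_pos)
  \<comment> \<open>The constants come from the quotient estimate for \<open>a / G - b / H\<close> below, with \<open>b \<le> W\<close> and \<open>G, H \<ge> m\<close>.\<close>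
  define A B where "A = (1 / m + W * T / m\<^sup>2) * L / lam" and "B = W * L / (m\<^sup>2 * lam)"
  have AB: "A \<ge> 0" "B \<ge> 0" using m W L True lam_pos by (auto simp: A_def B_def)
  show ?thesis
  proof (intro exI[of _ "A + B * T"] conjI allI impI)
    show "A + B * T \<ge> 0" using AB True by simp
    fix x y :: "real \<Rightarrow> real" and r :: real
    assume x: "continuous_on {0..} x" and y: "continuous_on {0..} y" and r: "0 \<le> r" "r \<le> T"
    define I where "I t = integral {0..t} (\<lambda>t. \<bar>x t - y t\<bar>)" for t
    have cd: "continuous_on {0..t} (\<lambda>t. \<bar>x t - y t\<bar>)" for t
      by (intro continuous_intros continuous_on_subset[OF x] continuous_on_subset[OF y]) auto
    have cx: "continuous_on {0..t} (slope_at x)" "continuous_on {0..t} (flux_density_at x)"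
      and cy: "continuous_on {0..t} (slope_at y)" "continuous_on {0..t} (flux_density_at y)" for t
      using continuous_on_slope_at[OF x] continuous_on_slope_at[OF y]
        continuous_on_flux_density_at[OF x] continuous_on_flux_density_at[OF y]
      by (auto intro: continuous_on_subset)
    have Imono: "I t \<le> I r" if "t \<in> {0..r}" for t
      unfolding I_def using that
      by (intro integral_subset_le integrable_continuous_interval cd) auto
    have I0: "I t \<ge> 0" for t
      unfolding I_def by (intro integral_nonneg integrable_continuous_interval cd) auto
    have slopes: "\<bar>slope_at x t - slope_at y t\<bar> \<le> L * \<bar>x t - y t\<bar>" if "t \<in> {0..r}" for t
      using L(2)[of t] that r by (simp add: slope_at_def)
    have heights: "\<bar>height_at x t - height_at y t\<bar> \<le> L * I r" if t: "t \<in> {0..r}" for t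
    proof -
      have "height_at x t - height_at y t = integral {0..t} (\<lambda>s. slope_at x s - slope_at y s)"
        unfolding height_at_def
        by (subst integral_diff) (auto intro: integrable_continuous_interval cx cy)
      also have "\<bar>\<dots>\<bar> \<le> integral {0..t} (\<lambda>s. L * \<bar>x s - y s\<bar>)"
        unfolding real_norm_def[symmetric]
        using slopes t by (intro integral_norm_bound_integral integrable_continuous_interval continuous_intros cx cy cd[unfolded real_norm_def[symmetric]]) auto
      also have "\<dots> = L * I t" by (simp add: I_def)
      also have "\<dots> \<le> L * I r" using Imono[OF t] L by (simp add: mult_left_mono)
      finally show ?thesis .
    qed
    have flux_density: "\<bar>flux_density_at x t - flux_density_at y t\<bar> \<le> A * \<bar>x t - y t\<bar> + B * I r" if t: "t \<in> {0..r}" for t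
    proof -
      define p q G H where "p = slope_at x t" and "q = slope_at y t" and "G = gap_at x t" and "H = gap_at y t"
      define a b where "a = sqrt (1 + p\<^sup>2)" and "b = sqrt (1 + q\<^sup>2)"
      have GH: "G \<ge> m" "H \<ge> m" using gap_at_pos by (auto simp: G_def H_def m_def)
      have pos: "G > 0" "H > 0" using GH m by auto
      have pq: "\<bar>p - q\<bar> \<le> L * \<bar>x t - y t\<bar>" using slopes[OF t] by (simp add: p_def q_def)
      have ab: "\<bar>a - b\<bar> \<le> L * \<bar>x t - y t\<bar>"
        using sqrt_one_plus_square_lipschitz[of p q] pq by (simp add: a_def b_def)
      have "q \<ge> 0" "q \<le> slope_bound T"
        using cut_slope_bounds[of t "y t"] slope_bound_mono[of t T] t r by (auto simp: q_def slope_at_def)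
      then have b: "0 \<le> b" "b \<le> W" by (auto simp: b_def W_def power_mono)
      have "\<bar>G - H\<bar> \<le> \<bar>t * (p - q) - (height_at x t - height_at y t)\<bar>"
        unfolding G_def H_def gap_at_def p_def q_def by (auto simp: max_def algebra_simps)
      also have "\<dots> \<le> t * \<bar>p - q\<bar> + \<bar>height_at x t - height_at y t\<bar>"
        using t abs_triangle_ineq4[of "t * (p - q)"] by (simp add: abs_mult)
      also have "\<dots> \<le> T * (L * \<bar>x t - y t\<bar>) + L * I r"
        using t r pq heights[OF t] by (intro add_mono mult_mono) auto
      finally have GHd: "\<bar>G - H\<bar> \<le> T * (L * \<bar>x t - y t\<bar>) + L * I r" .
      \<comment> \<open>Split so that each term contains only one of the two differences.\<close>
      have "flux_density_at x t - flux_density_at y t = ((a - b) / G + b * (H - G) / (G * H)) / lam"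
        unfolding flux_density_at_def p_def[symmetric] q_def[symmetric] G_def[symmetric] H_def[symmetric]
          a_def[symmetric] b_def[symmetric]
        using pos lam_pos by (simp add: field_simps)
      also have "\<bar>\<dots>\<bar> \<le> (\<bar>a - b\<bar> / G + b * \<bar>G - H\<bar> / (G * H)) / lam"
      proof -
        have "\<bar>(a - b) / G + b * (H - G) / (G * H)\<bar> \<le> \<bar>(a - b) / G\<bar> + \<bar>b * (H - G) / (G * H)\<bar>"
          by (rule abs_triangle_ineq)
        also have "\<dots> = \<bar>a - b\<bar> / G + b * \<bar>G - H\<bar> / (G * H)"
          using pos b by (simp add: abs_mult abs_minus_commute)
        finally show ?thesis using lam_pos by (simp add: divide_right_mono)
      qed
      also have "\<dots> \<le> (L * \<bar>x t - y t\<bar> / m + W * (T * (L * \<bar>x t - y t\<bar>) + L * I r) / (m * m)) / lam"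
        using ab GHd GH b m lam_pos W I0 by (intro divide_right_mono add_mono frac_le mult_mono) auto
      also have "\<dots> = A * \<bar>x t - y t\<bar> + B * I r"
        using m lam_pos unfolding A_def B_def by (simp add: field_simps power2_eq_square)
      finally show ?thesis .
    qed
    have "flux_operator x r - flux_operator y r = integral {0..r} (\<lambda>t. t ^ k * (flux_density_at x t - flux_density_at y t)) / r ^ k"
      unfolding flux_operator_def diff_divide_distrib[symmetric] right_diff_distrib
      by (subst integral_diff) (auto intro: integrable_continuous_interval continuous_on_integrand x y)
    also have "\<bar>\<dots>\<bar> \<le> integral {0..r} (\<lambda>t. \<bar>flux_density_at x t - flux_density_at y t\<bar>)"
      by (intro weighted_average_bound continuous_intros cx cy r)
    also have "\<dots> \<le> integral {0..r} (\<lambda>t. A * \<bar>x t - y t\<bar> + B * I r)"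
      by (intro integral_le integrable_continuous_interval continuous_intros cx cy cd flux_density)
    also have "\<dots> = A * I r + B * I r * r"
      using r by (subst integral_add) (auto intro!: integrable_continuous_interval continuous_intros cd simp: I_def)
    also have "\<dots> \<le> A * I r + B * I r * T"
      using r AB I0[of r] by (simp add: mult_left_mono)
    finally show "\<bar>flux_operator x r - flux_operator y r\<bar> \<le> (A + B * T) * integral {0..r} (\<lambda>t. \<bar>x t - y t\<bar>)"
      by (simp add: I_def algebra_simps)
  qed
qed

section \<open>Existence and uniqueness of the global profile\<close>

text \<open>Where the cut-offs are inactive, the fixed point equation is the integrated divergence form.  Differentiating it
  and converting from the sine back to the slope recovers the equation.\<close>
lemma profile_on_if_cut_inactive:
  assumes S: "continuous_on {0..} S" and fixp: "\<And>r. r \<ge> 0 \<Longrightarrow> flux_operator S r = S r"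
    and inactive: "\<And>r. 0 \<le> r \<Longrightarrow> r < R \<Longrightarrow> S r \<le> sine_bound r \<and> r * slope_at S r - height_at S r \<ge> - \<mu> / 2"
  shows "profile_on R (height_at S) (slope_at S)"
  unfolding profile_on_def
proof (intro conjI ballI)
  have S0: "S r \<ge> 0" if "r \<ge> 0" for r
    using flux_operator_nonneg[OF S that] fixp[OF that] by simp
  have slope: "slope_at S r = slope_of_sine (S r)" if "0 \<le> r" "r < R" for r
    using inactive[OF that] S0[OF that(1)] by (simp add: slope_at_def cut_slope_inactive)
  have S1: "\<bar>S r\<bar> < 1" if "0 \<le> r" "r < R" for r
    using inactive[OF that] S0[OF that(1)] sine_bound[OF that(1)] by simp
  show "height_at S 0 = \<mu>" by (simp add: height_at_def)
  have "S 0 = 0" using fixp[of 0] flux_operator_0[OF S] by simp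
  then show "slope_at S 0 = 0" using sine_bound[of 0] by (simp add: slope_at_def cut_slope_def slope_of_sine_def)
  show "continuous_on {0..<R} (height_at S)" "continuous_on {0..<R} (slope_at S)"
    by (auto intro: continuous_on_subset[OF continuous_on_height_at[OF S]] continuous_on_subset[OF continuous_on_slope_at[OF S]])
  show "r * slope_at S r - height_at S r > 0" if "r \<in> {0..<R}" for r
    using inactive[of r] that mu by auto
  fix r assume r: "r \<in> {0<..<R}"
  show "(height_at S has_real_derivative slope_at S r) (at r)"
    using height_at_derivative[OF S, of r R] r by (simp add: at_within_Icc_at)
  define p w g where "p = slope_at S r" and "w = sqrt (1 + p\<^sup>2)" and "g = r * p - height_at S r"
  have w: "w > 0" "1 + p\<^sup>2 = w\<^sup>2" using sqrt_one_plus_square_pos by (auto simp: w_def add_nonneg_nonneg)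
  have g: "g > 0" using inactive[of r] r mu by (auto simp: g_def p_def)
  have Sr: "S r = p / w"
    using sine_of_slope_of_sine[OF S1, of r] slope[of r] r by (auto simp: p_def w_def sine_of_slope_def)
  have flux_density: "flux_density_at S r = w / (lam * g)"
    using inactive[of r] r by (simp add: flux_density_at_def gap_at_def w_def p_def g_def)
  have "((\<lambda>r. integral {0..r} (\<lambda>t. t ^ k * flux_density_at S t)) has_real_derivative r ^ k * flux_density_at S r) (at r)"
    using flux_integral_derivative[OF S, of r R] r by (simp add: at_within_Icc_at)
  from DERIV_divide[OF this DERIV_pow[of k r UNIV]] r
  have "(flux_operator S has_real_derivative
      (r ^ k * flux_density_at S r * r ^ k - integral {0..r} (\<lambda>t. t ^ k * flux_density_at S t) * (k * r ^ (k - 1))) / (r ^ k * r ^ k)) (at r)"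
    by (simp add: flux_operator_def[abs_def])
  also have "(r ^ k * flux_density_at S r * r ^ k - integral {0..r} (\<lambda>t. t ^ k * flux_density_at S t) * (k * r ^ (k - 1))) / (r ^ k * r ^ k)
     = flux_density_at S r - k * S r / r"
  proof -
    have int: "integral {0..r} (\<lambda>t. t ^ k * flux_density_at S t) = S r * r ^ k"
      using fixp[of r] r by (simp add: flux_operator_def field_simps)
    have rk: "r ^ k = r * r ^ (k - 1)" using k by (cases k) auto
    show ?thesis unfolding int using r by (simp add: rk field_simps)
  qed
  finally have "(S has_real_derivative flux_density_at S r - k * S r / r) (at r)"
    by (rule has_field_derivative_transform_within_open[of _ _ _ "{0<..}"]) (use r fixp in auto)
  from DERIV_slope_of_sine[OF this S1] r
  have "((\<lambda>r. slope_of_sine (S r)) has_real_derivative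
     (flux_density_at S r - k * S r / r) / ((1 - (S r)\<^sup>2) * sqrt (1 - (S r)\<^sup>2))) (at r)" by simp
  moreover have "(flux_density_at S r - k * S r / r) / ((1 - (S r)\<^sup>2) * sqrt (1 - (S r)\<^sup>2)) = slope_rate r (height_at S r) p"
  proof -
    have p2: "p\<^sup>2 = w\<^sup>2 - 1" using w by simp
    \<comment> \<open>In terms of \<open>w\<close> the cosine is \<open>1 / w\<close>, so the chain rule contributes the factor \<open>w ^ 3\<close>.\<close>
    have 1: "1 - (S r)\<^sup>2 = 1 / w\<^sup>2"
      unfolding Sr power_divide p2 using w(1) by (simp add: field_simps)
    have 2: "sqrt (1 / w\<^sup>2) = 1 / w" using w(1) by (simp add: real_sqrt_divide)
    show ?thesis
      unfolding 1 2 unfolding slope_rate_def flux_density Sr w(2) g_def[symmetric]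
      using w(1) g lam_pos r by (simp add: field_simps power2_eq_square)
  qed
  ultimately have "((\<lambda>r. slope_of_sine (S r)) has_real_derivative slope_rate r (height_at S r) p) (at r)" by simp
  then show "(slope_at S has_real_derivative slope_rate r (height_at S r) (slope_at S r)) (at r)"
    unfolding p_def
    by (rule has_field_derivative_transform_within_open[of _ _ _ "{0<..<R}"]) (use r slope in auto)
qed

text \<open>The set \<open>B\<close> of radii at which a cut-off is reached is closed.  If it were nonempty, the a priori bounds would hold
  before its least element \<open>R\<close> and pass to \<open>R\<close> in the limit.  They are strictly inside the cut-offs:
  \<open>1 + p\<^sup>2 \<le> (slope_bound R)\<^sup>2\<close> forces \<open>p < slope_bound R\<close>, and \<open>- \<mu> > - \<mu> / 2\<close>.  So \<open>R\<close> would not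
  belong to \<open>B\<close>.\<close>
lemma global_profile_exists:
  obtains f p where "\<And>R. profile_on R f p"
proof -
  obtain S where S: "continuous_on {0..} S" and fixp: "\<And>r. r \<ge> 0 \<Longrightarrow> flux_operator S r = S r"
    using volterra_fixed_point_exists[of flux_operator, OF flux_operator_lipschitz continuous_on_flux_operator]
    by blast
  define p f where "p = slope_at S" and "f = height_at S"
  define ok where "ok r \<longleftrightarrow> S r < sine_bound r \<and> r * p r - f r > - \<mu> / 2" for r
  have cp: "continuous_on {0..} p" and cf: "continuous_on {0..} f"
    unfolding p_def f_def using continuous_on_slope_at[OF S] continuous_on_height_at[OF S] by auto
  have csb: "continuous_on {0..} sine_bound"
    unfolding sine_bound_def[abs_def] by (intro continuous_intros continuous_on_slope_bound)
  have "ok r" if "r \<ge> 0" for r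
  proof (rule ccontr)
    assume "\<not> ok r"
    define B where "B = {x \<in> {0..}. sine_bound x \<le> S x} \<union> {x \<in> {0..}. x * p x - f x \<le> - \<mu> / 2}"
    have B: "x \<in> B \<longleftrightarrow> x \<ge> 0 \<and> \<not> ok x" for x by (auto simp: B_def ok_def)
    have "closed B" unfolding B_def
      by (intro closed_Un continuous_on_closed_Collect_le continuous_intros cp cf S csb closed_atLeast)
    moreover have "r \<in> B" using \<open>\<not> ok r\<close> that by (simp add: B)
    moreover have bdd: "bdd_below B" by (auto simp: B intro!: bdd_belowI[of _ 0])
    ultimately have inB: "Inf B \<in> B" using closed_contains_Inf[of B] by blast
    define R where "R = Inf B"
    have R: "R \<ge> 0" "\<not> ok R" using inB by (auto simp: R_def B)
    have before: "ok x" if "0 \<le> x" "x < R" for x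
      using cInf_lower[OF _ bdd, of x] that B by (force simp: R_def)
    have "S 0 = 0" using fixp[of 0] flux_operator_0[OF S] by simp
    then have "ok 0" using sine_bound[of 0] mu by (simp add: ok_def f_def height_at_def)
    then have "R > 0" using R by (cases "R = 0") auto
    have prof: "profile_on R f p"
      unfolding f_def p_def
      by (rule profile_on_if_cut_inactive[OF S fixp])
        (use before in \<open>auto simp: ok_def f_def p_def less_imp_le\<close>)
    have lim: "(g \<longlongrightarrow> g R) (at_left R)" if "continuous (at R within {0..}) g" for g :: "real \<Rightarrow> real"
    proof -
      have "(g \<longlongrightarrow> g R) (at R within {0..<R})"
        using that unfolding continuous_within by (rule tendsto_within_subset) auto
      moreover have "at R within {0..<R} = at_left R"
        by (rule at_within_nhd[of _ "{0<..}"]) (use \<open>R > 0\<close> in auto)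
      ultimately show ?thesis by simp
    qed
    have ev: "\<forall>\<^sub>F x in at_left R. 0 < x \<and> x < R"
      using eventually_at_left_real[OF \<open>R > 0\<close>] by simp
    have "1 + (p R)\<^sup>2 \<le> (slope_bound R)\<^sup>2"
    proof (rule tendsto_le[OF _ lim lim])
      show "continuous (at R within {0..}) (\<lambda>r. (slope_bound r)\<^sup>2)" "continuous (at R within {0..}) (\<lambda>r. 1 + (p r)\<^sup>2)"
        using R cp continuous_on_slope_bound by (auto intro!: continuous_intros simp: continuous_on_eq_continuous_within)
      show "\<forall>\<^sub>F x in at_left R. 1 + (p x)\<^sup>2 \<le> (slope_bound x)\<^sup>2"
        using ev by eventually_elim (use slope_bound_sq[OF prof] in auto)
    qed simp
    then have "(p R)\<^sup>2 < (slope_bound R)\<^sup>2" by simp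
    then have "p R < slope_bound R" using slope_bound_ge_1[OF R(1)] by (simp add: power2_less_imp_less)
    moreover have "- \<mu> \<le> R * p R - f R"
    proof (rule tendsto_le[OF _ lim tendsto_const])
      show "continuous (at R within {0..}) (\<lambda>r. r * p r - f r)"
        using R cp cf by (auto intro!: continuous_intros simp: continuous_on_eq_continuous_within)
      show "\<forall>\<^sub>F x in at_left R. - \<mu> \<le> x * p x - f x"
        using ev by eventually_elim (use gap_lower_bound[OF prof] in auto)
    qed simp
    ultimately have "S R \<ge> sine_bound R" using R(2) mu by (auto simp: ok_def)
    then have "p R = slope_bound R"
      using sine_bound[OF R(1)] by (simp add: p_def slope_at_def cut_slope_def min_absorb2 sine_bound_def)
    with \<open>p R < slope_bound R\<close> show False by simp
  qed
  then have "profile_on R f p" for R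
    unfolding f_def p_def
    by (intro profile_on_if_cut_inactive[OF S fixp]) (auto simp: ok_def f_def p_def less_imp_le)
  with that show ?thesis by blast
qed

lemma continuous_on_atLeast0_of_Ico:
  assumes "\<And>R. continuous_on {0..<R} (f :: real \<Rightarrow> real)" shows "continuous_on {0..} f"
proof (rule continuous_on_atLeast0I)
  show "continuous_on {0..T} f" for T
    by (rule continuous_on_subset[OF assms[of "T + 1"]]) auto
qed

lemma profile_height_integral:
  assumes prof: "\<And>R. profile_on R f p" and r: "r \<ge> 0"
  shows "f r = \<mu> + integral {0..r} p"
proof -
  have cf: "continuous_on {0..r} f"
    by (rule continuous_on_subset[OF profile_onD(3)[OF prof[of "r + 1"]]]) auto
  have "(p has_integral f r - f 0) {0..r}"
    using profile_onD(5)[OF prof[of "r + 1"]]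
    by (intro fundamental_theorem_of_calculus_interior r cf)
      (auto simp: has_real_derivative_iff_has_vector_derivative)
  then show ?thesis using profile_onD(1)[OF prof[of 1]] by (simp add: integral_unique)
qed

text \<open>By the a priori bounds a global profile never reaches the cut-offs, so the flux operator acts on its sine as
  the integrated divergence form.\<close>
lemma profile_fixed_point:
  assumes prof: "\<And>R. profile_on R f p"
  defines "S \<equiv> \<lambda>r. sine_of_slope (p r)"
  shows "continuous_on {0..} S" "\<And>r. r \<ge> 0 \<Longrightarrow> slope_at S r = p r" "\<And>r. r \<ge> 0 \<Longrightarrow> flux_operator S r = S r"
proof -
  have cp: "continuous_on {0..} p"
    by (rule continuous_on_atLeast0_of_Ico) (rule profile_onD(4)[OF prof])
  then show "continuous_on {0..} S" unfolding S_def by (rule continuous_on_sine_of_slope)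
  have p0: "p r \<ge> 0" if "r \<ge> 0" for r
    using slope_pos[OF prof[of "r + 1"], of r] profile_onD(2)[OF prof[of 1]] that by (cases "r = 0") (auto simp: less_imp_le)
  show sl: "slope_at S r = p r" if r: "r \<ge> 0" for r
  proof -
    have "(p r)\<^sup>2 \<le> (slope_bound r)\<^sup>2" using slope_bound_sq[OF prof[of "r + 1"], of r] r by simp
    then have "p r \<le> slope_bound r" by (rule power2_le_imp_le) (use slope_bound_ge_1[OF r] in simp)
    then show ?thesis
      unfolding slope_at_def S_def using p0[OF r]
      by (subst cut_slope_inactive) (auto simp: sine_bound_def intro: sine_of_slope_nonneg sine_of_slope_mono)
  qed
  have height: "height_at S r = f r" if r: "r \<ge> 0" for r
  proof -
    have "integral {0..r} (slope_at S) = integral {0..r} p"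
      by (rule integral_cong) (use sl in auto)
    then show ?thesis using profile_height_integral[OF prof r] by (simp add: height_at_def)
  qed
  have flux_density: "flux_density_at S r = flux_density r (f r) (p r)" if r: "r \<ge> 0" for r
    using gap_lower_bound[OF prof[of "r + 1"], of r] r mu
    by (simp add: flux_density_at_def gap_at_def flux_density_def sl[OF r] height[OF r])
  show "flux_operator S r = S r" if r: "r \<ge> 0" for r
  proof (cases "r = 0")
    case True
    then show ?thesis using profile_onD(2)[OF prof[of 1]] by (simp add: flux_operator_def S_def sine_of_slope_def)
  next
    case False
    have "((\<lambda>t. t ^ k * flux_density_at S t) has_integral r ^ k * S r - 0 ^ k * S 0) {0..r}"
    proof (rule fundamental_theorem_of_calculus_interior[OF r])
      show "continuous_on {0..r} (\<lambda>r. r ^ k * S r)"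
        unfolding S_def by (intro continuous_intros continuous_on_subset[OF cp]) auto
      fix x assume x: "x \<in> {0<..<r}"
      then show "((\<lambda>r. r ^ k * S r) has_vector_derivative x ^ k * flux_density_at S x) (at x)"
        unfolding has_real_derivative_iff_has_vector_derivative[symmetric] S_def
        using DERIV_flux[OF _ profile_onD(6)[OF prof[of r]], of x] flux_density[of x] by (simp add: S_def)
    qed
    then show ?thesis
      using False by (simp add: flux_operator_def integral_unique power_0_left)
  qed
qed

lemma global_profile_unique:
  assumes "\<And>R. profile_on R f p" "\<And>R. profile_on R g q" "r \<ge> 0"
  shows "f r = g r"
proof -
  have "p t = q t" if "t \<ge> 0" for t
  proof -
    have "sine_of_slope (p t) = sine_of_slope (q t)"
      by (rule volterra_fixed_point_unique[OF flux_operator_lipschitz profile_fixed_point(1,3)[OF assms(1)]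
            profile_fixed_point(1,3)[OF assms(2)] that])
    then show ?thesis by (metis slope_of_sine_of_slope)
  qed
  then have "integral {0..r} p = integral {0..r} q" by (intro integral_cong) auto
  then show ?thesis
    using profile_height_integral[OF assms(1,3)] profile_height_integral[OF assms(2,3)] by simp
qed

section \<open>Profiles and solutions of the initial value problem\<close>

text \<open>The only point beyond unfolding definitions is the sign of the gap: it is continuous, equals \<open>- \<mu> > 0\<close> at \<open>0\<close> and
  does not vanish, so it stays positive.\<close>
lemma ivp_solution_imp_profile:
  assumes sol: "ivp_solution (k + 1) lam \<mu> f"
  shows "profile_on R f (hderiv f)"
proof -
  define p where "p = hderiv f"
  have diff: "f differentiable_on {0..}" and cp: "continuous_on {0..} p"
    and C2: "p C1_differentiable_on {0<..}" and f0: "f 0 = \<mu>" and p0: "p 0 = 0"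
    and nz: "\<And>r. r > 0 \<Longrightarrow> r * p r - f r \<noteq> 0"
    and eq: "\<And>r. r > 0 \<Longrightarrow> deriv p r + real k / r * (1 + (p r)\<^sup>2) * p r
          - 1 / lam * ((1 + (p r)\<^sup>2)\<^sup>2 / (r * p r - f r)) = 0"
    using sol by (auto simp: ivp_solution_def C1_closed_half_line_def C2_open_half_line_def p_def)
  have cf: "continuous_on {0..} f" using diff by (rule differentiable_imp_continuous_on)
  have df: "(f has_real_derivative p r) (at r)" if "r > 0" for r
  proof -
    have "(f has_vector_derivative p r) (at r within {0..})"
      unfolding p_def hderiv_def using diff that
      by (simp add: vector_derivative_works differentiable_on_def)
    moreover have "at r within {0..} = at r" by (rule at_within_interior) (use that in simp)
    ultimately show ?thesis by (simp add: has_real_derivative_iff_has_vector_derivative)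
  qed
  have dp: "(p has_real_derivative slope_rate r (f r) (p r)) (at r)" if r: "r > 0" for r
  proof -
    obtain D where "\<And>x. x > 0 \<Longrightarrow> (p has_vector_derivative D x) (at x)"
      using C2 unfolding C1_differentiable_on_def by auto
    then have "(p has_real_derivative D r) (at r)" using r by (simp add: has_real_derivative_iff_has_vector_derivative)
    moreover have "slope_rate r (f r) (p r) = deriv p r"
      using eq[OF r] by (simp add: slope_rate_def)
    ultimately show ?thesis by (metis DERIV_imp_deriv)
  qed
  have gap: "r * p r - f r > 0" if r: "r \<ge> 0" for r
  proof (rule ccontr)
    assume "\<not> ?thesis"
    then have "\<exists>x\<ge>0. x \<le> r \<and> x * p x - f x = 0"
      using r f0 mu
      by (intro IVT2') (auto intro!: continuous_intros continuous_on_subset[OF cp] continuous_on_subset[OF cf])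
    then obtain x where "x \<ge> 0" "x * p x - f x = 0" by blast
    then show False using nz[of x] f0 mu by (cases "x = 0") auto
  qed
  show ?thesis
    unfolding profile_on_def p_def[symmetric]
    using f0 p0 df dp gap by (auto intro: continuous_on_subset[OF cp] continuous_on_subset[OF cf])
qed

text \<open>The derivative at the end point \<open>0\<close> is obtained from the integral representation of \<open>f\<close>, since profiles
  carry derivatives at positive radii only.\<close>
lemma hderiv_of_profile:
  assumes prof: "\<And>R. profile_on R f p" and r: "r \<ge> 0"
  shows "(f has_vector_derivative p r) (at r within {0..})" "hderiv f r = p r"
proof -
  have "continuous_on {0..r + 1} p"
    by (rule continuous_on_subset[OF profile_onD(4)[OF prof[of "r + 2"]]]) auto
  from integral_has_vector_derivative[OF this, of r] r
  have "((\<lambda>r. \<mu> + integral {0..r} p) has_vector_derivative p r) (at r within {0..r + 1})"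
    by (auto intro!: derivative_eq_intros)
  moreover have "at r within {0..r+1} = at r within {0..}"
    by (rule at_within_nhd[of _ "{..<r+1}"]) auto
  ultimately have "((\<lambda>r. \<mu> + integral {0..r} p) has_vector_derivative p r) (at r within {0..})" by simp
  then show d: "(f has_vector_derivative p r) (at r within {0..})"
    by (rule has_vector_derivative_transform[rotated 2])
      (use r profile_height_integral[OF prof] in auto)
  \<comment> \<open>The vector derivative within \<open>{0..}\<close> is unique only because no point of the half line is isolated.\<close>
  have "{0..} \<noteq> {x::real}" for x by (metis finite.intros infinite_Ici)
  then have "r islimpt {0..}" using r by (intro connected_imp_perfect) auto
  then have "at r within {0..} \<noteq> bot" by (simp add: trivial_limit_within)
  then show "hderiv f r = p r"
    unfolding hderiv_def by (rule vector_derivative_within[OF _ d])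
qed

lemma profile_imp_ivp_solution:
  assumes prof: "\<And>R. profile_on R f p"
  shows "ivp_solution (k + 1) lam \<mu> f"
proof -
  have cp: "continuous_on {0..} p" and cf: "continuous_on {0..} f"
    by (rule continuous_on_atLeast0_of_Ico, rule profile_onD[OF prof])+
  have hd: "hderiv f r = p r" if "r \<ge> 0" for r by (rule hderiv_of_profile(2)[OF prof that])
  have dp: "(hderiv f has_real_derivative slope_rate r (f r) (p r)) (at r)" if r: "r > 0" for r
  proof -
    have "(p has_real_derivative slope_rate r (f r) (p r)) (at r)"
      using profile_onD(6)[OF prof[of "r + 1"] r] by simp
    then show ?thesis
      by (rule has_field_derivative_transform_within_open[of _ _ _ "{0<..}"]) (use r hd in auto)
  qed
  have gap: "r * p r - f r > 0" if "r \<ge> 0" for r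
    using profile_onD(7)[OF prof[of "r + 1"] that] by simp
  have dfd: "f differentiable (at r within {0..})" if "r \<ge> 0" for r
    using hderiv_of_profile(1)[OF prof that] by (rule differentiableI_vector)
  have C1: "C1_closed_half_line f"
    unfolding C1_closed_half_line_def differentiable_on_def
    using dfd cp continuous_on_cong[OF refl, of "{0..}" "hderiv f" p] hd by auto
  have C2: "C2_open_half_line f"
    unfolding C2_open_half_line_def C1_differentiable_on_def
  proof (intro conjI exI ballI)
    show "f differentiable_on {0<..}"
      using C1 unfolding C1_closed_half_line_def by (auto intro: differentiable_on_subset)
    show "(hderiv f has_vector_derivative slope_rate r (f r) (p r)) (at r)" if "r \<in> {0<..}" for r
      using dp[of r] that by (simp add: has_real_derivative_iff_has_vector_derivative)
    have "lam * (r * p r - f r) \<noteq> 0" if "r \<in> {0<..}" for r using gap[of r] that lam_pos by auto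
    then show "continuous_on {0<..} (\<lambda>r. slope_rate r (f r) (p r))"
      unfolding slope_rate_def
      by (intro continuous_intros continuous_on_subset[OF cp] continuous_on_subset[OF cf]) auto
  qed
  show ?thesis
    unfolding ivp_solution_def
  proof (intro conjI allI impI C1 C2)
    fix r :: real assume r: "r > 0"
    show "r * hderiv f r - f r \<noteq> 0" using gap[of r] hd[of r] r by simp
    show "deriv (hderiv f) r + (real (k + 1) - 1) / r * (1 + (hderiv f r)\<^sup>2) * hderiv f r
        - 1 / lam * ((1 + (hderiv f r)\<^sup>2)\<^sup>2 / (r * hderiv f r - f r)) = 0"
      using DERIV_imp_deriv[OF dp[OF r]] hd[of r] r by (simp add: slope_rate_def)
  next
    show "f 0 = \<mu>" "hderiv f 0 = 0" using hd[of 0] profile_onD(1,2)[OF prof[of 1]] by auto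
  qed
qed

end

theorem theorem1p1:
  fixes n :: nat and lam \<mu> :: real
  assumes "n \<ge> 2" and "lam > 1 / (real n - 1)" and "\<mu> < 0"
  shows "\<exists>f. ivp_solution n lam \<mu> f
           \<and> (\<forall>g. ivp_solution n lam \<mu> g \<longrightarrow> (\<forall>r\<ge>0. g r = f r))
           \<and> (\<forall>r\<ge>0. r * hderiv f r > f r)
           \<and> (\<forall>r>0. hderiv f r > 0)"
proof -
  define k where "k = n - 1"
  have n: "n = k + 1" using assms(1) by (simp add: k_def)
  interpret expander_params k lam \<mu>
    using assms by unfold_locales (auto simp: n field_simps)
  obtain f p where prof: "\<And>R. profile_on R f p" using global_profile_exists by blast
  have hd: "hderiv f r = p r" if "r \<ge> 0" for r by (rule hderiv_of_profile(2)[OF prof that])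
  show ?thesis
  proof (intro exI[of _ f] conjI allI impI)
    show "ivp_solution n lam \<mu> f" unfolding n by (rule profile_imp_ivp_solution[OF prof])
    show "g r = f r" if "ivp_solution n lam \<mu> g" "r \<ge> 0" for g r
    proof (rule global_profile_unique[OF _ prof that(2)])
      show "profile_on R g (hderiv g)" for R
        using that(1) unfolding n by (rule ivp_solution_imp_profile)
    qed
    show "r * hderiv f r > f r" if "r \<ge> 0" for r
      using profile_onD(7)[OF prof[of "r + 1"] that] hd[OF that] by simp
    show "hderiv f r > 0" if "r > 0" for r
      using slope_pos[OF prof[of "r + 1"] that] hd[of r] that by simp
  qed
qed

end
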